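(* Let $n\ge 1$ and $m$ be integers with $n-1\le m\le \binom{n}{2}$ and let $B(n,m)=\max\{\delta(G): G\in\mathcal{G}(n,m)\}$. Then: (1) if $n\ge 1$ and $m=n-1$, then $B(n,m)=0$; (2) if $n\ge 3$ and $n\le m\le n+3$, then $B(n,m)=n/4$; (3) if $r$ is an integer with $2\le r\le n/2$ and $M(n,r)<m\le M(n,r-1)$, then $B(n,m)\le r/2$.
   Context: $\mathcal{G}(n,m)$ is the set of simple connected graphs with $n$ vertices and $m$ edges, in which every edge has length $1$. A graph $G$ is regarded as a metric space whose points are the vertices together with all interior points of edges: each edge is identified isometrically with $[0,1]$ and $d(x,y)$ is the length of a shortest path in $G$ joining $x$ and $y$; this makes $G$ a geodesic metric space. A geodesic triangle $T$ with vertices $x_1,x_2,x_3\in G$ (arbitrary points, not necessarily graph vertices, possibly repeated) is a union of three geodesics $[x_1x_2],[x_2x_3],[x_3x_1]$. It is $\delta$-thin if every point of each side is at distance at most $\delta$ from the union of the two other sides; $\delta(T)$ is the infimum of the $\delta\ge 0$ for which $T$ is $\delta$-thin, and the hyperbolicity constant is $\delta(G)=\sup\{\delta(T): T \text{ a geodesic triangle in } G\}$. The numbers $M(n,r)$, for integers $1\le r\le n/2$ (and $M(n,1)$ for all $n$), are: $M(n,1)=\frac{n(n-1)}{2}$, $M(n,2)=\frac12(n^2-n-2)$, $M(n,3)=\frac12(n^2-3n+2)$, and $M(n,r)=\frac12\left[(n-2r+3)^2+5n-19\right]$ for $r\ge 4$. *)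

theory Defs
  imports "HOL-Analysis.Analysis"
begin

section \<open>Hyperbolicity constant of a metric space\<close>

definition is_geodesic :: "'p set \<Rightarrow> ('p \<Rightarrow> 'p \<Rightarrow> real) \<Rightarrow> 'p \<Rightarrow> 'p \<Rightarrow> 'p set \<Rightarrow> bool" where
  "is_geodesic X d x y A \<longleftrightarrow>
     (\<exists>L g. 0 \<le> L \<and> g \<in> {0..L} \<rightarrow> X \<and> g 0 = x \<and> g L = y \<and>
        (\<forall>s\<in>{0..L}. \<forall>t\<in>{0..L}. d (g s) (g t) = \<bar>s - t\<bar>) \<and> A = g ` {0..L})"

definition geodesic_triangle ::
    "'p set \<Rightarrow> ('p \<Rightarrow> 'p \<Rightarrow> real) \<Rightarrow> 'p set \<Rightarrow> 'p set \<Rightarrow> 'p set \<Rightarrow> bool" where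
  "geodesic_triangle X d A B C \<longleftrightarrow>
     (\<exists>x1\<in>X. \<exists>x2\<in>X. \<exists>x3\<in>X.
        is_geodesic X d x1 x2 A \<and> is_geodesic X d x2 x3 B \<and> is_geodesic X d x3 x1 C)"

definition dist_to_set :: "('p \<Rightarrow> 'p \<Rightarrow> real) \<Rightarrow> 'p \<Rightarrow> 'p set \<Rightarrow> real" where
  "dist_to_set d p A = (INF q\<in>A. d p q)"

definition thin_triangle ::
    "('p \<Rightarrow> 'p \<Rightarrow> real) \<Rightarrow> real \<Rightarrow> 'p set \<Rightarrow> 'p set \<Rightarrow> 'p set \<Rightarrow> bool" where
  "thin_triangle d \<delta> A B C \<longleftrightarrow>
     (\<forall>p\<in>A. dist_to_set d p (B \<union> C) \<le> \<delta>) \<and>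
     (\<forall>p\<in>B. dist_to_set d p (C \<union> A) \<le> \<delta>) \<and>
     (\<forall>p\<in>C. dist_to_set d p (A \<union> B) \<le> \<delta>)"

definition triangle_const :: "('p \<Rightarrow> 'p \<Rightarrow> real) \<Rightarrow> 'p set \<Rightarrow> 'p set \<Rightarrow> 'p set \<Rightarrow> real" where
  "triangle_const d A B C = Inf {\<delta>. 0 \<le> \<delta> \<and> thin_triangle d \<delta> A B C}"

text \<open>A supremum of reals: it is the mathematical one only if the set is bounded above, which
  lemma \<open>bdd_above_triangle_consts\<close> shows for finite connected graphs.\<close>

definition hyperbolicity_const :: "'p set \<Rightarrow> ('p \<Rightarrow> 'p \<Rightarrow> real) \<Rightarrow> real" where
  "hyperbolicity_const X d = Sup {triangle_const d A B C | A B C. geodesic_triangle X d A B C}"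

section \<open>Graphs as metric spaces\<close>

definition simple_graph :: "'v set \<Rightarrow> 'v set set \<Rightarrow> bool" where
  "simple_graph V E \<longleftrightarrow> finite V \<and> E \<subseteq> {{u, v} | u v. u \<in> V \<and> v \<in> V \<and> u \<noteq> v}"

definition connected_graph :: "'v set \<Rightarrow> 'v set set \<Rightarrow> bool" where
  "connected_graph V E \<longleftrightarrow>
     V \<noteq> {} \<and> (\<forall>u\<in>V. \<forall>v\<in>V. (u, v) \<in> {(a, b). {a, b} \<in> E}\<^sup>*)"

text \<open>Points of the metric graph are written in barycentric coordinates on the vertices: the vertex
  \<open>u\<close> is the indicator of \<open>{u}\<close>, and \<open>edge_point u v t\<close> is the point of the edge \<open>{u, v}\<close> at
  distance \<open>t\<close> from \<open>u\<close>. For \<open>u \<noteq> v\<close> this gives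
  \<open>edge_point u v t = edge_point v u (1 - t)\<close>, so that no orientation of the edges is needed.\<close>

definition edge_point :: "'v \<Rightarrow> 'v \<Rightarrow> real \<Rightarrow> 'v \<Rightarrow> real" where
  "edge_point u v t = (\<lambda>w. if w = u then 1 - t else if w = v then t else 0)"

definition graph_points :: "'v set \<Rightarrow> 'v set set \<Rightarrow> ('v \<Rightarrow> real) set" where
  "graph_points V E =
     {indicator {u} | u. u \<in> V} \<union> {edge_point u v t | u v t. {u, v} \<in> E \<and> 0 \<le> t \<and> t \<le> 1}"

text \<open>\<open>graph_path V E x y l\<close>: some path from \<open>x\<close> to \<open>y\<close>, composed of finitely many segments each
  contained in one closed edge, has length \<open>l\<close>.\<close>

inductive graph_path ::
    "'v set \<Rightarrow> 'v set set \<Rightarrow> ('v \<Rightarrow> real) \<Rightarrow> ('v \<Rightarrow> real) \<Rightarrow> real \<Rightarrow> bool"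
  for V :: "'v set" and E :: "'v set set" and x :: "'v \<Rightarrow> real" where
  refl: "x \<in> graph_points V E \<Longrightarrow> graph_path V E x x 0"
| step: "graph_path V E x (edge_point u v s) l \<Longrightarrow> {u, v} \<in> E \<Longrightarrow>
         0 \<le> s \<Longrightarrow> s \<le> 1 \<Longrightarrow> 0 \<le> t \<Longrightarrow> t \<le> 1 \<Longrightarrow>
         graph_path V E x (edge_point u v t) (l + \<bar>s - t\<bar>)"

text \<open>The value \<open>0\<close> off the graph only makes the library locale \<open>Metric_space\<close> applicable, since
  that locale requires nonnegativity outside the carrier, too.\<close>

definition graph_dist :: "'v set \<Rightarrow> 'v set set \<Rightarrow> ('v \<Rightarrow> real) \<Rightarrow> ('v \<Rightarrow> real) \<Rightarrow> real" where
  "graph_dist V E x y =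
     (if x \<in> graph_points V E \<and> y \<in> graph_points V E then Inf {l. graph_path V E x y l} else 0)"

definition graph_hyperbolicity :: "'v set \<Rightarrow> 'v set set \<Rightarrow> real" where
  "graph_hyperbolicity V E = hyperbolicity_const (graph_points V E) (graph_dist V E)"

text \<open>The graphs with \<open>n\<close> vertices are represented on the vertex set \<open>{..<n}\<close>; by lemma
  \<open>graph_hyperbolicity_in_range\<close> no value of the hyperbolicity constant is lost.\<close>

definition connected_graphs :: "nat \<Rightarrow> nat \<Rightarrow> (nat set \<times> nat set set) set" where
  "connected_graphs n m =
     {(V, E). V = {..<n} \<and> simple_graph V E \<and> connected_graph V E \<and> card E = m}"

definition max_hyperbolicity :: "nat \<Rightarrow> nat \<Rightarrow> real" where
  "max_hyperbolicity n m = Max {graph_hyperbolicity V E | V E. (V, E) \<in> connected_graphs n m}"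

text \<open>The numbers \<open>M(n, r)\<close>; only \<open>r \<ge> 1\<close> is meaningful.\<close>

definition edge_threshold :: "nat \<Rightarrow> nat \<Rightarrow> real" where
  "edge_threshold n r =
     (if r \<le> 1 then real n * (real n - 1) / 2
      else if r = 2 then 1 / 2 * (real n ^ 2 - real n - 2)
      else if r = 3 then 1 / 2 * (real n ^ 2 - 3 * real n + 2)
      else 1 / 2 * ((real n - 2 * real r + 3) ^ 2 + 5 * real n - 19))"

section \<open>Well-definedness\<close>

lemma finite_connected_graphs: "finite (connected_graphs n m)"
proof -
  have "connected_graphs n m \<subseteq> {{..<n}} \<times> Pow (Pow {..<n})"
    by (auto simp: connected_graphs_def simple_graph_def)
  then show ?thesis
    by (rule finite_subset) auto
qed

lemma finite_graph_hyperbolicities: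
  "finite {graph_hyperbolicity V E | V E. (V, E) \<in> connected_graphs n m}"
proof -
  have "{graph_hyperbolicity V E | V E. (V, E) \<in> connected_graphs n m}
      = (\<lambda>(V, E). graph_hyperbolicity V E) ` connected_graphs n m"
    by force
  then show ?thesis
    by (simp add: finite_connected_graphs)
qed

lemma simple_graphD:
  assumes "simple_graph V E" "{u, v} \<in> E"
  shows "u \<in> V" "v \<in> V" "u \<noteq> v"
  using assms unfolding simple_graph_def by (fastforce simp: doubleton_eq_iff)+

lemma edge_point_0: "u \<noteq> v \<Longrightarrow> edge_point u v 0 = indicator {u}"
  and edge_point_1: "u \<noteq> v \<Longrightarrow> edge_point u v 1 = indicator {v}"
  by (auto simp: edge_point_def fun_eq_iff indicator_def)

lemma edge_point_in_graph_points:
  "{u, v} \<in> E \<Longrightarrow> 0 \<le> t \<Longrightarrow> t \<le> 1 \<Longrightarrow> edge_point u v t \<in> graph_points V E"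
  by (auto simp: graph_points_def)

lemma graph_path_points:
  assumes "graph_path V E x y l"
  shows "x \<in> graph_points V E" "y \<in> graph_points V E" "0 \<le> l"
  using assms by (induction rule: graph_path.induct) (auto simp: edge_point_in_graph_points)

lemma graph_path_trans:
  assumes "graph_path V E y z l'" "graph_path V E x y l"
  shows "graph_path V E x z (l + l')"
  using assms
proof (induction rule: graph_path.induct)
  case (step u v s l' t)
  then have "graph_path V E x (edge_point u v t) ((l + l') + \<bar>s - t\<bar>)"
    by (intro graph_path.step) auto
  then show ?case by (simp add: add.assoc)
qed auto

lemma graph_path_edge:
  assumes "{u, v} \<in> E" "0 \<le> s" "s \<le> 1" "0 \<le> t" "t \<le> 1"
  shows "graph_path V E (edge_point u v s) (edge_point u v t) \<bar>s - t\<bar>"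
  using graph_path.step[OF graph_path.refl[OF edge_point_in_graph_points[OF assms(1-3)]] assms]
  by simp

lemma graph_path_sym: "graph_path V E x y l \<Longrightarrow> graph_path V E y x l"
proof (induction rule: graph_path.induct)
  case (step u v s l t)
  have "graph_path V E (edge_point u v t) (edge_point u v s) \<bar>t - s\<bar>"
    using step by (intro graph_path_edge) auto
  from graph_path_trans[OF step.IH this] show ?case
    by (simp add: abs_minus_commute add.commute)
qed (rule graph_path.refl)

lemma graph_path_vertices:
  assumes "simple_graph V E" "(u, v) \<in> {(a, b). {a, b} \<in> E}\<^sup>*" "u \<in> V"
  shows "\<exists>l. graph_path V E (indicator {u}) (indicator {v}) l"
  using assms(2)
proof (induction rule: rtrancl_induct)
  case base
  then show ?case
    using assms(3) by (intro exI[of _ 0] graph_path.refl) (auto simp: graph_points_def)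
next
  case (step v w)
  then obtain l where l: "graph_path V E (indicator {u}) (indicator {v}) l" by blast
  have e: "{v, w} \<in> E" using step by simp
  have "graph_path V E (edge_point v w 0) (edge_point v w 1) \<bar>0 - 1\<bar>"
    using e by (intro graph_path_edge) auto
  then have "graph_path V E (indicator {v}) (indicator {w}) 1"
    using simple_graphD[OF assms(1) e] by (simp add: edge_point_0 edge_point_1)
  from graph_path_trans[OF this l] show ?case by blast
qed

lemma graph_path_to_vertex:
  assumes "simple_graph V E" "x \<in> graph_points V E"
  shows "\<exists>u\<in>V. \<exists>l\<le>1. graph_path V E x (indicator {u}) l"
proof -
  consider u where "u \<in> V" "x = indicator {u}"
    | u v t where "{u, v} \<in> E" "0 \<le> t" "t \<le> 1" "x = edge_point u v t"
    using assms(2) unfolding graph_points_def by blast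
  then show ?thesis
  proof cases
    case 1
    then have "graph_path V E x (indicator {u}) 0"
      using assms(2) graph_path.refl[of x V E] by simp
    then show ?thesis using 1 by (intro bexI[of _ u] exI[of _ 0]) auto
  next
    case 2
    then have "graph_path V E x (edge_point u v 0) \<bar>t - 0\<bar>"
      using graph_path_edge[of u v E t 0] by simp
    then show ?thesis
      using 2 simple_graphD[OF assms(1) 2(1)]
      by (intro bexI[of _ u] exI[of _ t]) (auto simp: edge_point_0)
  qed
qed

lemma graph_path_exists_bounded:
  assumes "simple_graph V E" "connected_graph V E"
  shows "\<exists>K. \<forall>x\<in>graph_points V E. \<forall>y\<in>graph_points V E. \<exists>l\<le>K. graph_path V E x y l"
proof -
  have "\<exists>l. graph_path V E (indicator {u}) (indicator {v}) l" if "u \<in> V" "v \<in> V" for u v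
    using that assms graph_path_vertices[OF assms(1)] unfolding connected_graph_def by blast
  then obtain f where
    f: "\<And>u v. u \<in> V \<Longrightarrow> v \<in> V \<Longrightarrow> graph_path V E (indicator {u}) (indicator {v}) (f u v)"
    by metis
  define K where "K = Max ((\<lambda>(u, v). f u v) ` (V \<times> V))"
  have K: "f u v \<le> K" if "u \<in> V" "v \<in> V" for u v
    using that assms(1) unfolding K_def simple_graph_def by (intro Max_ge) auto
  have "\<exists>l\<le>K+2. graph_path V E x y l"
    if xy: "x \<in> graph_points V E" "y \<in> graph_points V E" for x y
  proof -
    obtain u l1 where u: "u \<in> V" "l1 \<le> 1" "graph_path V E x (indicator {u}) l1"
      using graph_path_to_vertex[OF assms(1) xy(1)] by blast
    obtain v l2 where v: "v \<in> V" "l2 \<le> 1" "graph_path V E y (indicator {v}) l2"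
      using graph_path_to_vertex[OF assms(1) xy(2)] by blast
    have "graph_path V E x y ((l1 + f u v) + l2)"
      by (rule graph_path_trans[OF graph_path_sym[OF v(3)] graph_path_trans[OF f[OF u(1) v(1)] u(3)]])
    then show ?thesis using K[OF u(1) v(1)] u(2) v(2) by (intro exI[of _ "(l1 + f u v) + l2"]) auto
  qed
  then show ?thesis by blast
qed

lemma graph_path_length_ge:
  assumes "simple_graph V E" "graph_path V E x y l"
  shows "\<bar>x w - y w\<bar> \<le> l"
  using assms(2)
proof (induction rule: graph_path.induct)
  case (step u v s l t)
  have "\<bar>edge_point u v s w - edge_point u v t w\<bar> \<le> \<bar>s - t\<bar>"
    by (auto simp: edge_point_def)
  then show ?case using step.IH by linarith
qed simp

lemma bdd_below_graph_path: "bdd_below {l. graph_path V E x y l}"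
  by (rule bdd_belowI[of _ 0]) (auto dest: graph_path_points)

lemma graph_dist_le: "graph_path V E x y l \<Longrightarrow> graph_dist V E x y \<le> l"
  using graph_path_points[of V E x y l] unfolding graph_dist_def
  by (auto intro!: cInf_lower bdd_below_graph_path)

lemma graph_dist_ge:
  assumes "simple_graph V E" "connected_graph V E"
    and "x \<in> graph_points V E" "y \<in> graph_points V E"
    and "\<And>l. graph_path V E x y l \<Longrightarrow> c \<le> l"
  shows "c \<le> graph_dist V E x y"
proof -
  have "{l. graph_path V E x y l} \<noteq> {}"
    using graph_path_exists_bounded[OF assms(1,2)] assms(3,4) by blast
  then show ?thesis
    using assms unfolding graph_dist_def by (auto intro!: cInf_greatest)
qed

lemma Metric_space_graph:
  assumes "simple_graph V E" "connected_graph V E"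
  shows "Metric_space (graph_points V E) (graph_dist V E)"
proof
  let ?P = "graph_points V E" and ?d = "graph_dist V E"
  show "0 \<le> ?d x y" for x y
    using graph_dist_ge[OF assms, of x y 0] graph_path_points(3)[of V E x y]
    by (cases "x \<in> ?P \<and> y \<in> ?P") (auto simp: graph_dist_def[of _ _ x y])
  show "?d x y = ?d y x" for x y
  proof -
    have "{l. graph_path V E x y l} = {l. graph_path V E y x l}"
      using graph_path_sym[of V E] by blast
    then show ?thesis by (simp add: graph_dist_def)
  qed
  show "?d x y = 0 \<longleftrightarrow> x = y" if xy: "x \<in> ?P" "y \<in> ?P" for x y
  proof
    assume 0: "?d x y = 0"
    have "\<bar>x w - y w\<bar> \<le> ?d x y" for w
      using graph_dist_ge[OF assms xy] graph_path_length_ge[OF assms(1)] by blast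
    with 0 show "x = y" by (auto simp: fun_eq_iff)
  next
    assume "x = y"
    then have "?d x y \<le> 0" using graph_dist_le[OF graph_path.refl[OF xy(1)]] by simp
    moreover have "0 \<le> ?d x y"
      using graph_dist_ge[OF assms xy, of 0] graph_path_points(3)[of V E x y] by blast
    ultimately show "?d x y = 0" by simp
  qed
  show "?d x z \<le> ?d x y + ?d y z" if xyz: "x \<in> ?P" "y \<in> ?P" "z \<in> ?P" for x y z
  proof -
    have "?d x z - l \<le> ?d y z" if l: "graph_path V E x y l" for l
    proof (rule graph_dist_ge[OF assms xyz(2,3)])
      fix l' assume "graph_path V E y z l'"
      from graph_dist_le[OF graph_path_trans[OF this l]] show "?d x z - l \<le> l'" by simp
    qed
    then have "?d x z - ?d y z \<le> l" if "graph_path V E x y l" for l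
      using that by force
    from graph_dist_ge[OF assms xyz(1,2) this] show ?thesis by simp
  qed
qed

lemma is_geodesicD:
  assumes "is_geodesic X d x y A"
  shows "A \<subseteq> X" "x \<in> A" "y \<in> A"
  using assms unfolding is_geodesic_def by force+

lemma bdd_above_triangle_consts:
  assumes "simple_graph V E" "connected_graph V E"
  shows "bdd_above {triangle_const (graph_dist V E) A B C | A B C.
           geodesic_triangle (graph_points V E) (graph_dist V E) A B C}"
proof -
  let ?P = "graph_points V E" and ?d = "graph_dist V E"
  interpret Metric_space ?P ?d by (rule Metric_space_graph[OF assms])
  obtain K where "\<forall>x\<in>?P. \<forall>y\<in>?P. \<exists>l\<le>K. graph_path V E x y l"
    using graph_path_exists_bounded[OF assms] by blast
  then have K: "?d x y \<le> K" if "x \<in> ?P" "y \<in> ?P" for x y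
    using that graph_dist_le[of V E x y] by (meson order_trans)
  have *: "dist_to_set ?d p A \<le> \<bar>K\<bar>" if "p \<in> ?P" "A \<subseteq> ?P" "q \<in> A" for p q A
  proof -
    have "dist_to_set ?d p A \<le> ?d p q"
      unfolding dist_to_set_def using that by (intro cINF_lower bdd_belowI[of _ 0]) auto
    also have "\<dots> \<le> K" using that by (intro K) auto
    finally show ?thesis by simp
  qed
  show ?thesis
  proof (rule bdd_aboveI[of _ "\<bar>K\<bar>"], clarify)
    fix A B C assume "geodesic_triangle ?P ?d A B C"
    then obtain x1 x2 x3 where g: "is_geodesic ?P ?d x1 x2 A" "is_geodesic ?P ?d x2 x3 B"
      "is_geodesic ?P ?d x3 x1 C"
      unfolding geodesic_triangle_def by blast
    note g' = is_geodesicD[OF g(1)] is_geodesicD[OF g(2)] is_geodesicD[OF g(3)]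
    have "thin_triangle ?d \<bar>K\<bar> A B C"
      unfolding thin_triangle_def using g' by (intro conjI ballI *) auto
    then show "triangle_const ?d A B C \<le> \<bar>K\<bar>"
      unfolding triangle_const_def by (intro cInf_lower bdd_belowI[of _ 0]) auto
  qed
qed

lemma triangle_consts_subset_of_isometry:
  assumes "F ` X = Y" and iso: "\<And>p q. p \<in> X \<Longrightarrow> q \<in> X \<Longrightarrow> d' (F p) (F q) = d p q"
  shows "{triangle_const d A B C | A B C. geodesic_triangle X d A B C}
       \<subseteq> {triangle_const d' A B C | A B C. geodesic_triangle Y d' A B C}"
proof clarify
  fix A B C assume "geodesic_triangle X d A B C"
  then obtain x1 x2 x3 where x: "x1 \<in> X" "x2 \<in> X" "x3 \<in> X"
    and g: "is_geodesic X d x1 x2 A" "is_geodesic X d x2 x3 B" "is_geodesic X d x3 x1 C"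
    unfolding geodesic_triangle_def by blast
  have geo: "is_geodesic Y d' (F x) (F y) (F ` A)" if "is_geodesic X d x y A" for x y A
  proof -
    from that obtain L g where Lg: "0 \<le> L" "g \<in> {0..L} \<rightarrow> X" "g 0 = x" "g L = y"
      "\<forall>s\<in>{0..L}. \<forall>t\<in>{0..L}. d (g s) (g t) = \<bar>s - t\<bar>" "A = g ` {0..L}"
      unfolding is_geodesic_def by blast
    show ?thesis unfolding is_geodesic_def
    proof (intro exI conjI)
      show "0 \<le> L" "(F \<circ> g) 0 = F x" "(F \<circ> g) L = F y" "F ` A = (F \<circ> g) ` {0..L}"
        "F \<circ> g \<in> {0..L} \<rightarrow> Y"
        using Lg assms(1) by (auto simp: image_comp)
      show "\<forall>s\<in>{0..L}. \<forall>t\<in>{0..L}. d' ((F \<circ> g) s) ((F \<circ> g) t) = \<bar>s - t\<bar>"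
      proof (intro ballI)
        fix s t assume st: "s \<in> {0..L}" "t \<in> {0..L}"
        then have "g s \<in> X" "g t \<in> X" using Lg(2) by auto
        with st Lg(5) show "d' ((F \<circ> g) s) ((F \<circ> g) t) = \<bar>s - t\<bar>" by (simp add: iso)
      qed
    qed
  qed
  have ds: "dist_to_set d' (F p) (F ` S) = dist_to_set d p S" if "p \<in> X" "S \<subseteq> X" for p S
    unfolding dist_to_set_def image_image
    using that by (intro INF_cong) (auto simp: iso subset_iff)
  note sub = is_geodesicD(1)[OF g(1)] is_geodesicD(1)[OF g(2)] is_geodesicD(1)[OF g(3)]
  have "thin_triangle d' \<delta> (F ` A) (F ` B) (F ` C) \<longleftrightarrow> thin_triangle d \<delta> A B C" for \<delta>
  proof -
    have one: "(\<forall>p\<in>F ` S. dist_to_set d' p (F ` T \<union> F ` U) \<le> \<delta>) \<longleftrightarrow>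
               (\<forall>p\<in>S. dist_to_set d p (T \<union> U) \<le> \<delta>)"
      if "S \<subseteq> X" "T \<subseteq> X" "U \<subseteq> X" for S T U
    proof -
      have "dist_to_set d' (F p) (F ` T \<union> F ` U) = dist_to_set d p (T \<union> U)" if "p \<in> S" for p
        using ds[of p "T \<union> U"] that \<open>S \<subseteq> X\<close> \<open>T \<subseteq> X\<close> \<open>U \<subseteq> X\<close> by (auto simp: image_Un)
      then show ?thesis by simp
    qed
    show ?thesis unfolding thin_triangle_def using sub by (simp only: one)
  qed
  then have "triangle_const d A B C = triangle_const d' (F ` A) (F ` B) (F ` C)"
    by (simp add: triangle_const_def)
  moreover have "geodesic_triangle Y d' (F ` A) (F ` B) (F ` C)"
    unfolding geodesic_triangle_def using geo g x assms(1) by blast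
  ultimately show "\<exists>A' B' C'. triangle_const d A B C = triangle_const d' A' B' C' \<and>
      geodesic_triangle Y d' A' B' C'" by blast
qed

definition relabel :: "'v set \<Rightarrow> ('v \<Rightarrow> 'w) \<Rightarrow> ('v \<Rightarrow> real) \<Rightarrow> 'w \<Rightarrow> real" where
  "relabel V f x = (\<lambda>w. if w \<in> f ` V then x (inv_into V f w) else 0)"

lemma relabel_indicator:
  assumes "inj_on f V" "u \<in> V"
  shows "relabel V f (indicator {u}) = indicator {f u}"
  using assms by (auto simp: relabel_def fun_eq_iff indicator_def inv_into_f_f)

lemma relabel_edge_point:
  assumes "inj_on f V" "u \<in> V" "v \<in> V"
  shows "relabel V f (edge_point u v t) = edge_point (f u) (f v) t"
  using assms by (auto simp: relabel_def fun_eq_iff edge_point_def inv_into_f_f)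

lemma relabel_graph_points:
  assumes "simple_graph V E" "inj_on f V" "x \<in> graph_points V E"
  shows "relabel V f x \<in> graph_points (f ` V) ((`) f ` E)"
proof -
  consider u where "u \<in> V" "x = indicator {u}"
    | u v t where "{u, v} \<in> E" "0 \<le> t" "t \<le> 1" "x = edge_point u v t"
    using assms(3) unfolding graph_points_def by blast
  then show ?thesis
  proof cases
    case 1
    then show ?thesis using assms(2) by (auto simp: relabel_indicator graph_points_def)
  next
    case 2
    have "{f u, f v} \<in> (`) f ` E" using imageI[OF 2(1), of "(`) f"] by simp
    then show ?thesis
      using 2 simple_graphD[OF assms(1) 2(1)] assms(2)
      by (simp add: relabel_edge_point edge_point_in_graph_points)
  qed
qed

lemma relabel_graph_path:
  assumes "simple_graph V E" "inj_on f V" "graph_path V E x y l"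
  shows "graph_path (f ` V) ((`) f ` E) (relabel V f x) (relabel V f y) l"
  using assms(3)
proof (induction rule: graph_path.induct)
  case refl
  then show ?case using assms by (intro graph_path.refl relabel_graph_points)
next
  case (step u v s l t)
  have "{f u, f v} \<in> (`) f ` E" using imageI[OF step.hyps(2), of "(`) f"] by simp
  then show ?case
    using step simple_graphD[OF assms(1) step.hyps(2)] assms(2)
      graph_path.step[of "f ` V" "(`) f ` E" "relabel V f x" "f u" "f v" s l t]
    by (simp add: relabel_edge_point)
qed

lemma simple_graph_relabel:
  assumes "simple_graph V E" "inj_on f V"
  shows "simple_graph (f ` V) ((`) f ` E)"
proof -
  have "f ` e \<in> {{u, v} | u v. u \<in> f ` V \<and> v \<in> f ` V \<and> u \<noteq> v}" if e: "e \<in> E" for e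
  proof -
    obtain u v where "e = {u, v}" "u \<in> V" "v \<in> V" "u \<noteq> v"
      using assms(1) e unfolding simple_graph_def by blast
    then have "f ` e = {f u, f v}" "f u \<in> f ` V" "f v \<in> f ` V" "f u \<noteq> f v"
      using assms(2) by (auto simp: inj_on_eq_iff)
    then show ?thesis by blast
  qed
  then show ?thesis using assms(1) unfolding simple_graph_def by blast
qed

lemma connected_graph_relabel:
  assumes "connected_graph V E"
  shows "connected_graph (f ` V) ((`) f ` E)"
proof -
  have "(f u, f v) \<in> {(a, b). {a, b} \<in> (`) f ` E}\<^sup>*" if "(u, v) \<in> {(a, b). {a, b} \<in> E}\<^sup>*" for u v
    using that
  proof (induction rule: rtrancl_induct)
    case (step v w)
    then have "{f v, f w} \<in> (`) f ` E" using imageI[of "{v, w}" E "(`) f"] by simp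
    then show ?case using step.IH by (auto intro: rtrancl_into_rtrancl)
  qed simp
  then show ?thesis using assms unfolding connected_graph_def by blast
qed

lemma relabel_inverse:
  assumes "simple_graph V E" "inj_on f V" "x \<in> graph_points V E"
  shows "relabel (f ` V) (inv_into V f) (relabel V f x) = x"
proof -
  have inj: "inj_on (inv_into V f) (f ` V)" by (simp add: inj_on_inv_into)
  consider u where "u \<in> V" "x = indicator {u}"
    | u v t where "{u, v} \<in> E" "0 \<le> t" "t \<le> 1" "x = edge_point u v t"
    using assms(3) unfolding graph_points_def by blast
  then show ?thesis
  proof cases
    case 1
    then show ?thesis using assms(2) inj by (simp add: relabel_indicator inv_into_f_f)
  next
    case 2
    then show ?thesis
      using simple_graphD[OF assms(1) 2(1)] assms(2) inj
      by (simp add: relabel_edge_point inv_into_f_f)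
  qed
qed

lemma graph_hyperbolicity_relabel:
  assumes G: "simple_graph V E" and f: "inj_on f V"
  shows "graph_hyperbolicity (f ` V) ((`) f ` E) = graph_hyperbolicity V E"
proof -
  let ?V = "f ` V" and ?E = "(`) f ` E" and ?g = "inv_into V f"
  let ?P = "graph_points V E" and ?P' = "graph_points (f ` V) ((`) f ` E)"
  let ?F = "relabel V f" and ?H = "relabel (f ` V) (inv_into V f)"
  have G': "simple_graph ?V ?E" by (rule simple_graph_relabel[OF G f])
  have g: "inj_on ?g ?V" by (simp add: inj_on_inv_into)
  have V: "?g ` ?V = V" using f by (simp add: inv_into_image_cancel)
  have "?g ` f ` e = e" if "e \<in> E" for e
  proof -
    have "e \<subseteq> V" using G that unfolding simple_graph_def by blast
    then show ?thesis using f by (simp add: inv_into_image_cancel)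
  qed
  then have E: "(`) ?g ` ?E = E" by (simp add: image_image)
  have HF: "?H (?F x) = x" if "x \<in> ?P" for x using relabel_inverse[OF G f that] .
  have HP: "?H y \<in> ?P" if "y \<in> ?P'" for y
    using relabel_graph_points[OF G' g that] by (simp only: V E)
  have FP: "?F x \<in> ?P'" if "x \<in> ?P" for x using relabel_graph_points[OF G f that] .
  have gf: "inv_into ?V ?g w = f w" if "w \<in> V" for w
    using that f g by (metis image_eqI inv_into_f_f)
  have "relabel V (inv_into ?V ?g) x = ?F x" if x: "x \<in> ?P" for x
  proof -
    have i: "inj_on (inv_into ?V ?g) V" using gf f by (simp add: inj_on_def)
    consider u where "u \<in> V" "x = indicator {u}"
      | u v t where "{u, v} \<in> E" "0 \<le> t" "t \<le> 1" "x = edge_point u v t"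
      using x unfolding graph_points_def by blast
    then show ?thesis
    proof cases
      case 1
      then show ?thesis using f i gf by (simp add: relabel_indicator)
    next
      case 2
      then show ?thesis
        using simple_graphD[OF G 2(1)] f i gf by (simp add: relabel_edge_point)
    qed
  qed
  then have FH: "?F (?H y) = y" if "y \<in> ?P'" for y
    using relabel_inverse[OF G' g that] HP[OF that] by (simp add: V)
  have iso: "graph_dist ?V ?E (?F p) (?F q) = graph_dist V E p q"
    if pq: "p \<in> ?P" "q \<in> ?P" for p q
  proof -
    have "graph_path V E p q l" if "graph_path ?V ?E (?F p) (?F q) l" for l
      using relabel_graph_path[OF G' g that] HF pq by (simp only: V E)
    then have "{l. graph_path ?V ?E (?F p) (?F q) l} = {l. graph_path V E p q l}"
      using relabel_graph_path[OF G f] by (intro Collect_cong) blast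
    then show ?thesis unfolding graph_dist_def if_P[OF conjI[OF pq]] if_P[OF conjI[OF FP FP, OF pq]]
      by (rule arg_cong)
  qed
  have FX: "?F ` ?P = ?P'" 
  proof (intro equalityI subsetI)
    fix y assume "y \<in> ?P'"
    then show "y \<in> ?F ` ?P" using HP FH by (intro image_eqI[of _ _ "?H y"]) simp_all
  qed (use FP in blast)
  have HX: "?H ` ?P' = ?P" 
  proof (intro equalityI subsetI)
    fix y assume "y \<in> ?P"
    then show "y \<in> ?H ` ?P'" using FP HF by (intro image_eqI[of _ _ "?F y"]) simp_all
  qed (use HP in blast)
  have iso': "graph_dist V E (?H p) (?H q) = graph_dist ?V ?E p q"
    if "p \<in> ?P'" "q \<in> ?P'" for p q
    using iso[OF HP[OF that(1)] HP[OF that(2)]] FH that by simp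
  show ?thesis
    unfolding graph_hyperbolicity_def hyperbolicity_const_def
    using triangle_consts_subset_of_isometry[where d = "graph_dist V E" and d' = "graph_dist ?V ?E",
        OF FX iso]
      triangle_consts_subset_of_isometry[where d = "graph_dist ?V ?E" and d' = "graph_dist V E",
        OF HX iso']
    by (intro arg_cong[of _ _ Sup] subset_antisym) assumption+
qed

lemma graph_hyperbolicity_in_range:
  fixes V :: "'v set"
  assumes "simple_graph V E" "connected_graph V E" "card V = n" "card E = m"
  shows "graph_hyperbolicity V E \<in>
           {graph_hyperbolicity V' E' | V' E'. (V', E') \<in> connected_graphs n m}"
proof -
  have "finite V" using assms(1) by (simp add: simple_graph_def)
  then obtain f where f: "bij_betw f V {..<n}"
    using assms(3) by (metis card_lessThan finite_lessThan finite_same_card_bij)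
  then have inj: "inj_on f V" and im: "f ` V = {..<n}" by (auto simp: bij_betw_def)
  have "inj_on ((`) f) (Pow V)" using inj by (simp add: inj_on_image_Pow)
  moreover have "E \<subseteq> Pow V" using assms(1) by (auto simp: simple_graph_def)
  ultimately have "card ((`) f ` E) = m"
    using assms(4) by (metis card_image inj_on_subset)
  then have "(f ` V, (`) f ` E) \<in> connected_graphs n m"
    using im simple_graph_relabel[OF assms(1) inj] connected_graph_relabel[OF assms(2), of f]
    by (simp add: connected_graphs_def)
  with graph_hyperbolicity_relabel[OF assms(1) inj] show ?thesis by force
qed

end

theory Submission
  imports Defs
begin

text \<open>
  If a point \<open>p\<close> on one side \<open>A\<close> of a triangle is farther than \<open>\<rho>\<close> from the other two sides, then the
  part of \<open>A\<close> around \<open>p\<close> and the detour along the other sides are two routes between the same ends,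
  and the detour avoids the ball of radius \<open>\<rho>\<close> around \<open>p\<close>. Everything follows from counting vertices
  on these two routes.

  \<^item> In a tree the two routes contradict the fact that deleting the edge through \<open>p\<close> disconnects.

  \<^item> A route that may use \<open>k\<close> vertices joins two of them by at most \<open>k - 1\<close> edges. Closing the two
    routes up gives \<open>4 \<rho> \<le> n\<close>. Equality is attained by an \<open>n\<close>-cycle with up to three additional chords
    near the ends of a bigon whose sides have length \<open>n / 2\<close>.

  \<^item> For \<open>r = 2\<close> and \<open>r = 3\<close> the number of edges forces vertex diameter at most \<open>r - 1\<close>. For \<open>r \<ge> 4\<close>
    and \<open>\<rho> > r / 2\<close>, slice the graph by the distance from an end of \<open>A\<close> into layers of height one. Each
    of \<open>r\<close> consecutive layers contains a vertex of either route, and edges join equal or consecutive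
    layers only. So a vertex outside these \<open>2 r\<close> ones has at most \<open>6\<close> neighbours among them, and they
    span at most \<open>5 (r - 1)\<close> edges, one pair in the layer of \<open>p\<close> being too far apart to be adjacent.
    With \<open>k = n - 2 r\<close> this bounds the number of edges by \<open>k (k - 1) / 2 + 6 k + 5 (r - 1) = M(n, r)\<close>.
\<close>

section \<open>The metric of a graph\<close>

lemma edge_point_swap: "u \<noteq> v \<Longrightarrow> edge_point u v t = edge_point v u (1 - t)"
  by (auto simp: edge_point_def fun_eq_iff)

text \<open>An interior point has both ends of its edge in its support, so comparing coordinates at
  the four ends recovers the edge up to orientation.\<close>

lemma edge_point_eq_interior:
  assumes "edge_point u v s = edge_point u' v' t" "0 < s" "s < 1" "u \<noteq> v" "u' \<noteq> v'"
  shows "(u' = u \<and> v' = v \<and> t = s) \<or> (u' = v \<and> v' = u \<and> t = 1 - s)"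
proof -
  have "edge_point u v s u = edge_point u' v' t u" "edge_point u v s v = edge_point u' v' t v"
    "edge_point u v s u' = edge_point u' v' t u'" "edge_point u v s v' = edge_point u' v' t v'"
    using assms(1) by simp_all
  then show ?thesis using assms(2-5)
    by (auto simp: edge_point_def split: if_splits)
qed

lemma edge_point_interior_not_vertex:
  assumes "0 < t" "t < 1" "u \<noteq> v"
  shows "edge_point u v t \<noteq> indicator {w}"
proof
  assume "edge_point u v t = indicator {w}"
  then have "edge_point u v t u = indicator {w} u" "edge_point u v t v = indicator {w} v" by simp_all
  then show False using assms by (auto simp: edge_point_def indicator_def split: if_splits)
qed

lemma indicator_singleton_eq_iff [simp]:
  "(indicator {u} :: 'v \<Rightarrow> real) = indicator {v} \<longleftrightarrow> u = v"
  by (auto simp: fun_eq_iff indicator_def)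

lemma geodesic_triangle_rotate:
  "geodesic_triangle X d A B C \<Longrightarrow> geodesic_triangle X d B C A"
  unfolding geodesic_triangle_def by blast

lemma is_geodesic_segment:
  assumes "g \<in> {0..L} \<rightarrow> X" "\<forall>s\<in>{0..L}. \<forall>t\<in>{0..L}. d (g s) (g t) = \<bar>s - t\<bar>"
    "0 \<le> a" "a \<le> b" "b \<le> L"
  shows "is_geodesic X d (g a) (g b) (g ` {a..b})"
  unfolding is_geodesic_def
proof (intro exI conjI)
  let ?h = "\<lambda>s. g (a + s)"
  show "0 \<le> b - a" "?h 0 = g a" "?h (b - a) = g b" "?h \<in> {0..b - a} \<rightarrow> X"
    using assms by auto
  show "\<forall>s\<in>{0..b - a}. \<forall>t\<in>{0..b - a}. d (?h s) (?h t) = \<bar>s - t\<bar>"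
    using assms by auto
  show "g ` {a..b} = ?h ` {0..b - a}"
    by (auto simp: image_iff Bex_def) (metis add.commute diff_add_cancel diff_ge_0_iff_ge diff_right_mono)
qed

locale metric_graph =
  fixes V :: "'v set" and E :: "'v set set"
  assumes simple: "simple_graph V E" and connected: "connected_graph V E"
begin

abbreviation "X \<equiv> graph_points V E"
abbreviation "d \<equiv> graph_dist V E"
abbreviation vtx :: "'v \<Rightarrow> 'v \<Rightarrow> real" where "vtx u \<equiv> indicator {u}"

sublocale Metric_space X d
  by (rule Metric_space_graph[OF simple connected])

lemma finite_V: "finite V" and V_nonempty: "V \<noteq> {}"
  using simple connected by (auto simp: simple_graph_def connected_graph_def)

lemma vtx_in_X: "u \<in> V \<Longrightarrow> vtx u \<in> X"
  by (auto simp: graph_points_def)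

lemmas edgeD = simple_graphD[OF simple]

lemma dist_same_edge_le:
  assumes "{u, v} \<in> E" "0 \<le> s" "s \<le> 1" "0 \<le> t" "t \<le> 1"
  shows "d (edge_point u v s) (edge_point u v t) \<le> \<bar>s - t\<bar>"
  by (rule graph_dist_le[OF graph_path_edge[OF assms]])

lemma dist_edge_end_le:
  assumes "{u, v} \<in> E" "0 \<le> t" "t \<le> 1"
  shows "d (vtx u) (edge_point u v t) \<le> t" "d (vtx v) (edge_point u v t) \<le> 1 - t"
  using dist_same_edge_le[OF assms(1), of 0 t] dist_same_edge_le[OF assms(1), of 1 t] assms
    edgeD[OF assms(1)] by (auto simp: edge_point_0 edge_point_1)

lemma dist_adjacent_le: "{u, v} \<in> E \<Longrightarrow> d (vtx u) (vtx v) \<le> 1"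
  using dist_edge_end_le(1)[of u v 1] edgeD[of u v] by (simp add: edge_point_1)

lemma graph_path_of_dist_less:
  assumes "x \<in> X" "y \<in> X" "d x y < c"
  shows "\<exists>l<c. graph_path V E x y l"
proof (rule ccontr)
  assume "\<not> ?thesis"
  then have "c \<le> d x y"
    by (intro graph_dist_ge[OF simple connected assms(1,2)]) force
  with assms(3) show False by simp
qed

text \<open>Every path is a chain of segments in closed edges, so a bound per edge adds up to its
  length. This serves \<open>barycentric_le_dist\<close> and the cut function in
  \<open>hyperbolicity_tree\<close>.\<close>

lemma lipschitz_le_dist:
  assumes lip: "\<And>u v (s::real) t. {u, v} \<in> E \<Longrightarrow> 0 \<le> s \<Longrightarrow> s \<le> 1 \<Longrightarrow> 0 \<le> t \<Longrightarrow> t \<le> 1 \<Longrightarrow>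
       \<bar>\<phi> (edge_point u v s) - \<phi> (edge_point u v t)\<bar> \<le> \<bar>s - t\<bar>"
    and "x \<in> X" "y \<in> X"
  shows "\<bar>\<phi> x - \<phi> y\<bar> \<le> (d x y :: real)"
proof (rule graph_dist_ge[OF simple connected assms(2,3)])
  fix l assume "graph_path V E x y l"
  then show "\<bar>\<phi> x - \<phi> y\<bar> \<le> l"
  proof (induction rule: graph_path.induct)
    case (step u v s l t)
    then show ?case using lip[of u v s t] by linarith
  qed simp
qed

lemma barycentric_edge_point:
  assumes "{u, v} \<in> E" "A \<subseteq> V"
  shows "(\<Sum>w\<in>A. edge_point u v t w * f w)
       = (if u \<in> A then (1 - t) * f u else 0) + (if v \<in> A then t * f v else 0)"
proof -
  have uv: "u \<noteq> v" "finite A" using edgeD[OF assms(1)] assms(2) finite_V finite_subset by auto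
  have "(\<Sum>w\<in>A. edge_point u v t w * f w)
      = (\<Sum>w\<in>A. (if w = u then (1 - t) * f u else 0) + (if w = v then t * f v else 0))"
    using uv by (intro sum.cong) (auto simp: edge_point_def)
  then show ?thesis using uv by (simp add: sum.distrib)
qed

text \<open>The barycentric sum extends \<open>f\<close> affinely along the edges, with slope
  \<open>f v - f u\<close> on \<open>{u, v}\<close>. Potentials on vertices thus bound distances
  between arbitrary points from below.\<close>

lemma barycentric_le_dist:
  assumes f: "\<And>u v. {u, v} \<in> E \<Longrightarrow> \<bar>f u - f v\<bar> \<le> 1" and "x \<in> X" "y \<in> X"
  shows "\<bar>(\<Sum>w\<in>V. x w * f w) - (\<Sum>w\<in>V. y w * f w)\<bar> \<le> d x y"
proof (rule lipschitz_le_dist[OF _ assms(2,3)])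
  fix u v and s t :: real assume e: "{u, v} \<in> E" and "0 \<le> s" "s \<le> 1" "0 \<le> t" "t \<le> (1::real)"
  have "(\<Sum>w\<in>V. edge_point u v s w * f w) - (\<Sum>w\<in>V. edge_point u v t w * f w)
      = (s - t) * (f v - f u)"
    using edgeD[OF e] by (simp add: barycentric_edge_point[OF e order_refl]) (simp add: algebra_simps)
  then show "\<bar>(\<Sum>w\<in>V. edge_point u v s w * f w) - (\<Sum>w\<in>V. edge_point u v t w * f w)\<bar> \<le> \<bar>s - t\<bar>"
    using f[OF e] mult_left_mono[of "\<bar>f v - f u\<bar>" 1 "\<bar>s - t\<bar>"] by (simp add: abs_mult abs_minus_commute)
qed

lemma barycentric_vtx: "u \<in> V \<Longrightarrow> (\<Sum>w\<in>V. vtx u w * f w) = f u"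
  using finite_V by (simp add: indicator_def if_distrib cong: if_cong)

lemma dist_vtx_ge_1:
  assumes "u \<in> V" "v \<in> V" "u \<noteq> v"
  shows "1 \<le> d (vtx u) (vtx v)"
proof -
  have "\<bar>vtx u u - vtx v u\<bar> \<le> d (vtx u) (vtx v)"
    using assms by (intro graph_dist_ge[OF simple connected] graph_path_length_ge[OF simple] vtx_in_X)
  then show ?thesis using assms by simp
qed

text \<open>A path that starts off the closed edge enters it through one of the ends and then has to
  cover the rest of the way along the edge.\<close>

lemma dist_edge_point_cases:
  assumes e: "{u, v} \<in> E" "0 \<le> t" "t \<le> 1" and x: "x \<in> X"
    and off: "\<And>s. 0 \<le> s \<Longrightarrow> s \<le> 1 \<Longrightarrow> x \<noteq> edge_point u v s"
  shows "min (d x (vtx u) + t) (d x (vtx v) + (1 - t)) \<le> d x (edge_point u v t)"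
proof (rule graph_dist_ge[OF simple connected x edge_point_in_graph_points[OF e]])
  fix l assume "graph_path V E x (edge_point u v t) l"
  \<comment> \<open>The induction covers every representation of the current endpoint on the edge,
    since the last segment may be written with another orientation or lie in another edge. At an
    interior endpoint the preceding point lies on the same edge.\<close>
  moreover have "\<forall>t. y = edge_point u v t \<longrightarrow> 0 \<le> t \<longrightarrow> t \<le> 1 \<longrightarrow>
     min (d x (vtx u) + t) (d x (vtx v) + (1 - t)) \<le> l" if "graph_path V E x y l" for y l
    using that
  proof (induction rule: graph_path.induct)
    case refl
    then show ?case using off by blast
  next
    case (step u' v' s l t')
    note uv = edgeD(3)[OF e(1)] edgeD(3)[OF step.hyps(2)]
    show ?case
    proof (intro allI impI)
      fix t assume t: "edge_point u' v' t' = edge_point u v t" "0 \<le> t" "t \<le> 1"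
      have le: "d x (edge_point u v t) \<le> l + \<bar>s - t'\<bar>"
        using graph_dist_le[OF graph_path.step[OF step.hyps]] t(1) by simp
      consider "t = 0" | "t = 1" | "0 < t" "t < 1" using t by linarith
      then show "min (d x (vtx u) + t) (d x (vtx v) + (1 - t)) \<le> l + \<bar>s - t'\<bar>"
      proof cases
        case 1
        then show ?thesis using le uv by (simp add: edge_point_0)
      next
        case 2
        then show ?thesis using le uv by (simp add: edge_point_1)
      next
        case 3
        from edge_point_eq_interior[OF t(1)[symmetric] 3 uv]
        consider "u' = u" "v' = v" "t' = t" | "u' = v" "v' = u" "t' = 1 - t" by blast
        then show ?thesis
        proof cases
          case 1
          then show ?thesis using step.IH[rule_format, of s] step.hyps by (auto simp: min_le_iff_disj)
        next
          case 2
          then show ?thesis using step.IH[rule_format, of "1 - s"] step.hyps edge_point_swap[OF uv(1), of "1 - s"]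
            by (auto simp: min_le_iff_disj)
        qed
      qed
    qed
  qed
  ultimately show "min (d x (vtx u) + t) (d x (vtx v) + (1 - t)) \<le> l"
    using e by blast
qed

lemma point_cases:
  assumes "x \<in> X"
  obtains (vertex) u where "u \<in> V" "x = vtx u"
  | (interior) u v t where "{u, v} \<in> E" "0 < t" "t < 1" "x = edge_point u v t"
proof -
  consider u where "u \<in> V" "x = vtx u"
    | u v t where "{u, v} \<in> E" "0 \<le> t" "t \<le> 1" "x = edge_point u v t"
    using assms unfolding graph_points_def by blast
  then show thesis
  proof cases
    case (2 u v t)
    note uv = edgeD[OF 2(1)]
    consider "t = 0" | "t = 1" | "0 < t" "t < 1" using 2 by linarith
    then show thesis
      using vertex[of u] vertex[of v] interior 2 uv by cases (auto simp: edge_point_0 edge_point_1)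
  qed (rule vertex)
qed

section \<open>Bounds for the hyperbolicity constant by far points\<close>

lemma dist_to_set_le: "q \<in> A \<Longrightarrow> dist_to_set d p A \<le> d p q"
  unfolding dist_to_set_def by (intro cINF_lower bdd_belowI[of _ 0]) auto

lemma dist_to_set_ge:
  "A \<noteq> {} \<Longrightarrow> (\<And>q. q \<in> A \<Longrightarrow> c \<le> d p q) \<Longrightarrow> c \<le> dist_to_set d p A"
  unfolding dist_to_set_def by (intro cINF_greatest)

lemma geodesic_trivial: "x \<in> X \<Longrightarrow> is_geodesic X d x x {x}"
  unfolding is_geodesic_def by (intro exI[of _ 0] exI[of _ "\<lambda>_. x"]) auto

lemma triangle_const_le:
  assumes "0 \<le> \<rho>" "thin_triangle d \<rho> A B C"
  shows "triangle_const d A B C \<le> \<rho>"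
  unfolding triangle_const_def using assms by (intro cInf_lower bdd_belowI[of _ 0]) auto

lemma triangle_exists: "\<exists>A B C. geodesic_triangle X d A B C"
proof -
  obtain u where "u \<in> V" using V_nonempty by blast
  then show ?thesis using vtx_in_X geodesic_trivial unfolding geodesic_triangle_def by blast
qed

text \<open>Rotation reduces the three thinness conditions to side \<open>A\<close>. In a
  counterexample the distance from \<open>p\<close> to the other sides serves as \<sigma>; it
  exceeds \<rho> strictly, which leaves room for small neighbourhoods.\<close>

lemma hyperbolicity_le:
  assumes "0 \<le> \<rho>"
    and far: "\<And>A B C p \<sigma>. geodesic_triangle X d A B C \<Longrightarrow> p \<in> A \<Longrightarrow> \<rho> < \<sigma> \<Longrightarrow>
      (\<And>q. q \<in> B \<union> C \<Longrightarrow> \<sigma> \<le> d p q) \<Longrightarrow> False"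
  shows "graph_hyperbolicity V E \<le> \<rho>"
  unfolding graph_hyperbolicity_def hyperbolicity_const_def
proof (rule cSup_least)
  show "{triangle_const d A B C |A B C. geodesic_triangle X d A B C} \<noteq> {}"
    using triangle_exists by blast
next
  have near: "dist_to_set d p (B \<union> C) \<le> \<rho>" if "geodesic_triangle X d A B C" "p \<in> A" for A B C p
  proof (rule ccontr)
    assume "\<not> ?thesis"
    then show False using far[OF that, of "dist_to_set d p (B \<union> C)"] dist_to_set_le by force
  qed
  fix \<delta> assume "\<delta> \<in> {triangle_const d A B C |A B C. geodesic_triangle X d A B C}"
  then obtain A B C where ABC: "\<delta> = triangle_const d A B C" "geodesic_triangle X d A B C" by blast
  note 2 = geodesic_triangle_rotate[OF ABC(2)]
  have "thin_triangle d \<rho> A B C"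
    unfolding thin_triangle_def
    using near[OF ABC(2)] near[OF 2] near[OF geodesic_triangle_rotate[OF 2]] by blast
  then show "\<delta> \<le> \<rho>" using ABC triangle_const_le assms(1) by simp
qed

lemma hyperbolicity_ge:
  assumes tri: "geodesic_triangle X d A B C" and p: "p \<in> A"
    and far: "\<And>q. q \<in> B \<union> C \<Longrightarrow> \<rho> \<le> d p q"
  shows "\<rho> \<le> graph_hyperbolicity V E"
  unfolding graph_hyperbolicity_def hyperbolicity_const_def
proof (rule cSup_upper2)
  show "bdd_above {triangle_const d A B C |A B C. geodesic_triangle X d A B C}"
    by (rule bdd_above_triangle_consts[OF simple connected])
  show "triangle_const d A B C \<in> {triangle_const d A B C |A B C. geodesic_triangle X d A B C}"
    using tri by blast
  obtain K where K: "\<And>x y. x \<in> X \<Longrightarrow> y \<in> X \<Longrightarrow> d x y \<le> K"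
    using graph_path_exists_bounded[OF simple connected] graph_dist_le by (metis order_trans)
  obtain x1 x2 x3 where g: "is_geodesic X d x1 x2 A" "is_geodesic X d x2 x3 B" "is_geodesic X d x3 x1 C"
    using tri unfolding geodesic_triangle_def by blast
  note g' = is_geodesicD[OF g(1)] is_geodesicD[OF g(2)] is_geodesicD[OF g(3)]
  have *: "dist_to_set d p S \<le> \<bar>K\<bar>" if "p \<in> X" "S \<subseteq> X" "q \<in> S" for p q S
    using dist_to_set_le[OF that(3), of p] K[of p q] that by force
  \<comment> \<open>A bound on the diameter is an admissible thinness constant, so the infimum below
    is taken over a nonempty set.\<close>
  then have thin: "thin_triangle d \<bar>K\<bar> A B C"
    unfolding thin_triangle_def using g' by (intro conjI ballI *) auto
  show "\<rho> \<le> triangle_const d A B C"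
    unfolding triangle_const_def
  proof (rule cInf_greatest)
    show "{\<delta>. 0 \<le> \<delta> \<and> thin_triangle d \<delta> A B C} \<noteq> {}" using thin abs_ge_zero by blast
    fix \<delta> assume "\<delta> \<in> {\<delta>. 0 \<le> \<delta> \<and> thin_triangle d \<delta> A B C}"
    then have "dist_to_set d p (B \<union> C) \<le> \<delta>" using p by (auto simp: thin_triangle_def)
    moreover have "\<rho> \<le> dist_to_set d p (B \<union> C)" using g' far by (intro dist_to_set_ge) auto
    ultimately show "\<rho> \<le> \<delta>" by simp
  qed
qed

lemma hyperbolicity_nonneg: "0 \<le> graph_hyperbolicity V E"
proof -
  obtain u where "u \<in> V" using V_nonempty by blast
  then have "geodesic_triangle X d {vtx u} {vtx u} {vtx u}"
    using vtx_in_X geodesic_trivial unfolding geodesic_triangle_def by blast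
  then show ?thesis by (rule hyperbolicity_ge) auto
qed

text \<open>The ends of \<open>A\<close> lie on \<open>C\<close> and \<open>B\<close>, hence they
  are far from \<open>p\<close> as well. This places \<open>s\<close> at least \<sigma> away from
  both ends of the parameter interval.\<close>

lemma far_point:
  assumes tri: "geodesic_triangle X d A B C" and p: "p \<in> A"
    and far: "\<And>q. q \<in> B \<union> C \<Longrightarrow> \<sigma> \<le> d p q"
  obtains g L s x where "g \<in> {0..L} \<rightarrow> X"
    "\<forall>a\<in>{0..L}. \<forall>b\<in>{0..L}. d (g a) (g b) = \<bar>a - b\<bar>"
    "is_geodesic X d (g 0) (g L) A" "is_geodesic X d (g L) x B" "is_geodesic X d x (g 0) C"
    "A = g ` {0..L}" "p = g s" "0 \<le> s" "s \<le> L" "\<sigma> \<le> s" "\<sigma> \<le> L - s"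
proof -
  obtain x1 x2 x3 where x: "is_geodesic X d x1 x2 A" "is_geodesic X d x2 x3 B" "is_geodesic X d x3 x1 C"
    using tri unfolding geodesic_triangle_def by blast
  obtain L g where Lg: "0 \<le> L" "g \<in> {0..L} \<rightarrow> X" "g 0 = x1" "g L = x2"
    "\<forall>s\<in>{0..L}. \<forall>t\<in>{0..L}. d (g s) (g t) = \<bar>s - t\<bar>" "A = g ` {0..L}"
    using x(1) unfolding is_geodesic_def by blast
  obtain s where s: "p = g s" "0 \<le> s" "s \<le> L" using p Lg(6) by auto
  have "\<sigma> \<le> d p x1" "\<sigma> \<le> d p x2"
    using far is_geodesicD(2)[OF x(2)] is_geodesicD(3)[OF x(3)] by auto
  moreover have iso: "d (g s) (g t) = \<bar>s - t\<bar>" if "0 \<le> t" "t \<le> L" for t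
    using Lg(5) s that by simp
  ultimately have "\<sigma> \<le> s" "\<sigma> \<le> L - s"
    using iso[of 0] iso[of L] Lg(1,3,4) s by simp_all
  then show thesis using that[of g L x3 s] Lg s x by simp
qed

section \<open>Chains of points and walks of vertices\<close>

text \<open>The reflexive transitive closure replaces continuous curves in \<open>F\<close>. Lengths
  are dropped, because later only the vertices that a route can visit are counted.\<close>

definition edge_steps :: "('v \<Rightarrow> real) set \<Rightarrow> (('v \<Rightarrow> real) \<times> ('v \<Rightarrow> real)) set" where
  "edge_steps F = {(x, y). x \<in> F \<and> y \<in> F \<and>
     (\<exists>u v s t. {u, v} \<in> E \<and> 0 \<le> s \<and> s \<le> 1 \<and> 0 \<le> t \<and> t \<le> 1 \<and>
        x = edge_point u v s \<and> y = edge_point u v t)}"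

lemma edge_steps_sym: "(x, y) \<in> (edge_steps F)\<^sup>* \<Longrightarrow> (y, x) \<in> (edge_steps F)\<^sup>*"
proof -
  have "sym (edge_steps F)" by (force simp: sym_def edge_steps_def)
  then show "(x, y) \<in> (edge_steps F)\<^sup>* \<Longrightarrow> (y, x) \<in> (edge_steps F)\<^sup>*"
    using sym_rtrancl symD by metis
qed

lemma edge_steps_graph_path:
  assumes "graph_path V E x y l" "\<And>z. z \<in> X \<Longrightarrow> d x z \<le> l \<Longrightarrow> z \<in> F"
  shows "(x, y) \<in> (edge_steps F)\<^sup>*"
  using assms
proof (induction rule: graph_path.induct)
  case (step u v s l t)
  have "(x, edge_point u v s) \<in> (edge_steps F)\<^sup>*"
    using step.prems by (intro step.IH) auto
  moreover have "d x (edge_point u v s) \<le> l" "d x (edge_point u v t) \<le> l + \<bar>s - t\<bar>"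
    using graph_dist_le[OF step.hyps(1)] graph_dist_le[OF graph_path.step[OF step.hyps]] .
  then have "edge_point u v s \<in> F" "edge_point u v t \<in> F"
    using step.prems step.hyps edge_point_in_graph_points[OF step.hyps(2)] by auto
  then have "(edge_point u v s, edge_point u v t) \<in> edge_steps F"
    using step.hyps unfolding edge_steps_def by blast
  ultimately show ?case by simp
qed simp

lemma edge_steps_near:
  assumes "x \<in> X" "y \<in> X" "d x y < c" "\<And>z. z \<in> X \<Longrightarrow> d x z < c \<Longrightarrow> z \<in> F"
  shows "(x, y) \<in> (edge_steps F)\<^sup>*"
proof -
  obtain l where "l < c" "graph_path V E x y l"
    using graph_path_of_dist_less[OF assms(1-3)] by blast
  then show ?thesis using assms(4) by (intro edge_steps_graph_path) auto
qed

text \<open>The geodesic is cut into pieces shorter than \<eta>. The ends of a piece are joined by a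
  path of length below \<eta>, which stays close to \<open>A\<close> but need not follow it; hence
  \<open>F\<close> has to contain a neighbourhood of \<open>A\<close>.\<close>

lemma edge_steps_geodesic:
  assumes geo: "is_geodesic X d x y A" and "0 < \<eta>"
    and F: "\<And>z q. z \<in> X \<Longrightarrow> q \<in> A \<Longrightarrow> d q z < \<eta> \<Longrightarrow> z \<in> F"
  shows "(x, y) \<in> (edge_steps F)\<^sup>*"
proof -
  obtain L g where Lg: "0 \<le> L" "g \<in> {0..L} \<rightarrow> X" "g 0 = x" "g L = y"
    "\<forall>s\<in>{0..L}. \<forall>t\<in>{0..L}. d (g s) (g t) = \<bar>s - t\<bar>" "A = g ` {0..L}"
    using geo unfolding is_geodesic_def by blast
  obtain N :: nat where N: "L / \<eta> < real N" using reals_Archimedean2 by blast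
  have N0: "0 < real N" using N Lg(1) assms(2) by (meson divide_nonneg_pos le_less_trans)
  have h: "0 \<le> L / N" "L / N < \<eta>" using N N0 Lg(1) assms(2) by (auto simp: field_simps)
  have "(x, g (real i * (L / N))) \<in> (edge_steps F)\<^sup>*" if "i \<le> N" for i
    using that
  proof (induction i)
    case 0
    then show ?case using Lg(3) by simp
  next
    case (Suc i)
    let ?s = "real i * (L / N)" and ?t = "real (Suc i) * (L / N)"
    have "?t \<le> real N * (L / N)" using Suc.prems h by (intro mult_right_mono) auto
    then have *: "0 \<le> ?s" "?s \<le> ?t" "?t \<le> L" "?t - ?s = L / N"
      using h N0 Lg(1) by (auto simp: algebra_simps add_divide_distrib)
    then have "d (g ?s) (g ?t) = L / N" using Lg(5) by auto
    then have "(g ?s, g ?t) \<in> (edge_steps F)\<^sup>*"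
      using * h Lg(2,6) by (intro edge_steps_near[of _ _ \<eta>] F[of _ "g ?s"]) auto
    then show ?case using Suc by (meson Suc_leD rtrancl_trans)
  qed
  from this[of N] show ?thesis using N0 Lg(4) by simp
qed

text \<open>The points that a chain of steps inside \<open>F\<close> can occupy when \<open>K\<close> is the set of vertices and \<open>D\<close>
  the set of edges already visited. Only the points of the chain have to lie in \<open>F\<close>, not the
  segments between them.\<close>

definition reached :: "'v set \<Rightarrow> 'v set set \<Rightarrow> ('v \<Rightarrow> real) \<Rightarrow> bool" where
  "reached K D z \<longleftrightarrow> (\<exists>u\<in>K. z = vtx u) \<or>
     (\<exists>u v t. {u, v} \<in> D \<and> 0 < t \<and> t < 1 \<and> z = edge_point u v t)"

text \<open>By \<open>KD\<close> all edges at a visited vertex are available, and by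
  \<open>DK\<close> an available edge has no unvisited end in \<open>F\<close>. This makes
  \<open>reached\<close> an invariant of the chain.\<close>

lemma reached_edge_steps:
  assumes xy: "(x, y) \<in> (edge_steps F)\<^sup>*" and x: "reached K D x" and D: "D \<subseteq> E"
    and KD: "\<And>u v. u \<in> K \<Longrightarrow> {u, v} \<in> E \<Longrightarrow> {u, v} \<in> D"
    and DK: "\<And>u v. {u, v} \<in> D \<Longrightarrow> vtx v \<in> F \<Longrightarrow> v \<in> K"
  shows "reached K D y"
  using xy x
proof (induction rule: rtrancl_induct)
  case (step y z)
  then have y: "reached K D y" by simp
  obtain u v s t where e: "{u, v} \<in> E" "0 \<le> s" "s \<le> 1" "0 \<le> t" "t \<le> 1"
    "y = edge_point u v s" "z = edge_point u v t" "z \<in> F"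
    using step.hyps(2) unfolding edge_steps_def by blast
  have uv: "u \<noteq> v" "v \<noteq> u" using edgeD(3)[OF e(1)] by auto
  \<comment> \<open>From a visited vertex the next edge is available by \<open>KD\<close>; an
    interior point determines its edge, which is in \<open>D\<close> already.\<close>
  have inD: "{u, v} \<in> D"
  proof -
    consider w where "w \<in> K" "y = vtx w"
      | a b \<tau> where "{a, b} \<in> D" "0 < \<tau>" "\<tau> < 1" "y = edge_point a b \<tau>"
      using y unfolding reached_def by blast
    then show ?thesis
    proof cases
      case 1
      then have "s = 0 \<or> s = 1"
        using edge_point_interior_not_vertex[of s u v w] e uv by fastforce
      then have "w = u \<or> w = v"
        using 1 e uv by (auto simp: edge_point_0 edge_point_1)
      then show ?thesis using KD[of u v] KD[of v u] 1 e(1) by (auto simp: insert_commute)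
    next
      case 2
      have "a \<noteq> b" using 2 D edgeD(3) by blast
      then have "{u, v} = {a, b}"
        using edge_point_eq_interior[of a b \<tau> u v s] 2 e uv by auto
      then show ?thesis using 2 by simp
    qed
  qed
  then have K: "vtx u \<in> F \<Longrightarrow> u \<in> K" "vtx v \<in> F \<Longrightarrow> v \<in> K"
    using DK[of u v] DK[of v u] by (auto simp: insert_commute)
  consider "t = 0" | "t = 1" | "0 < t" "t < 1" using e by linarith
  then show ?case
  proof cases
    case 3
    then show ?thesis using inD e(7) unfolding reached_def by blast
  qed (use K e uv in \<open>auto simp: reached_def edge_point_0 edge_point_1\<close>)
qed

definition adj_in :: "'v set \<Rightarrow> ('v \<times> 'v) set" where
  "adj_in U = {(a, b). {a, b} \<in> E \<and> a \<in> U \<and> b \<in> U}"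

text \<open>The witness \<open>c\<close> is the successor of the last visit to \<open>a\<close>, so
  the rest of the walk avoids \<open>a\<close>.\<close>

lemma adj_in_first_step:
  assumes "(a, b) \<in> (adj_in U)\<^sup>*" "a \<noteq> b"
  shows "\<exists>c. {a, c} \<in> E \<and> c \<in> U - {a} \<and> (c, b) \<in> (adj_in (U - {a}))\<^sup>*"
  using assms
proof (induction rule: rtrancl_induct)
  case (step x y)
  show ?case
  proof (cases "x = a")
    case True
    then show ?thesis using step by (intro exI[of _ y]) (auto simp: adj_in_def)
  next
    case False
    then obtain c where c: "{a, c} \<in> E" "c \<in> U - {a}" "(c, x) \<in> (adj_in (U - {a}))\<^sup>*"
      using step.IH by blast
    have "(x, y) \<in> adj_in (U - {a})" using step False by (auto simp: adj_in_def)
    then show ?thesis using c by (meson rtrancl_into_rtrancl)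
  qed
qed simp

text \<open>Discarding the start after its last visit uses up one vertex and at most one unit of
  distance. Induction on \<open>U\<close> thus does without simple paths.\<close>

lemma dist_le_card:
  assumes "finite U" "U \<subseteq> V" "(a, b) \<in> (adj_in U)\<^sup>*" "a \<in> U"
  shows "d (vtx a) (vtx b) \<le> real (card U) - 1"
  using assms
proof (induction U arbitrary: a rule: finite_psubset_induct)
  case (psubset U)
  have U: "1 \<le> card U" using psubset.hyps psubset.prems(3) by (metis One_nat_def Suc_leI card_gt_0_iff empty_iff)
  show ?case
  proof (cases "a = b")
    case True
    then show ?thesis using U psubset.prems vtx_in_X[of a] by (auto simp: mdist_zero subset_iff)
  next
    case False
    then obtain c where c: "{a, c} \<in> E" "c \<in> U - {a}" "(c, b) \<in> (adj_in (U - {a}))\<^sup>*"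
      using adj_in_first_step[OF psubset.prems(2)] by blast
    have "(c, b) \<in> (adj_in U)\<^sup>*"
      using c(3) by (rule rtrancl_mono[THEN subsetD, rotated]) (auto simp: adj_in_def)
    have bU: "b \<in> U"
      using psubset.prems(2,3) by (induction rule: rtrancl_induct) (auto simp: adj_in_def)
    have X: "vtx a \<in> X" "vtx b \<in> X" "vtx c \<in> X"
      using bU c(2) psubset.prems by (auto intro!: vtx_in_X)
    have "d (vtx c) (vtx b) \<le> real (card (U - {a})) - 1"
      using psubset.prems c by (intro psubset.IH) auto
    moreover have "real (card (U - {a})) = real (card U) - 1"
      using psubset.prems psubset.hyps U by (simp add: of_nat_diff)
    ultimately show ?thesis
      using triangle[OF X(1,3,2)] dist_adjacent_le[OF c(1)] by simp
  qed
qed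

text \<open>A point farther than \<open>D / 2\<close> from both ends of its side would make that
  side longer than \<open>D\<close>.\<close>

lemma hyperbolicity_le_diameter:
  assumes D: "\<And>x y. x \<in> X \<Longrightarrow> y \<in> X \<Longrightarrow> d x y \<le> D"
  shows "graph_hyperbolicity V E \<le> D / 2"
proof (rule hyperbolicity_le)
  obtain u where "u \<in> V" using V_nonempty by blast
  then show "0 \<le> D / 2" using D[of "vtx u" "vtx u"] vtx_in_X by simp
  fix A B C p \<sigma>
  assume *: "geodesic_triangle X d A B C" "p \<in> A" "D / 2 < \<sigma>" "\<And>q. q \<in> B \<union> C \<Longrightarrow> \<sigma> \<le> d p q"
  obtain g L s x where g: "g \<in> {0..L} \<rightarrow> X"
    "\<forall>a\<in>{0..L}. \<forall>b\<in>{0..L}. d (g a) (g b) = \<bar>a - b\<bar>" "0 \<le> s" "s \<le> L" "\<sigma> \<le> s" "\<sigma> \<le> L - s"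
    using far_point[OF *(1,2,4)] by metis
  have "d (g 0) (g L) = L" "g 0 \<in> X" "g L \<in> X" using g by auto
  then show False using D[of "g 0" "g L"] g *(3) by simp
qed

lemma near_vertex:
  assumes "x \<in> X"
  obtains u where "u \<in> V" "d x (vtx u) \<le> 1 / 2"
  using assms
proof (cases rule: point_cases)
  case (vertex u)
  then show thesis using that[of u] assms by simp
next
  case (interior u v t)
  then show thesis
    using that[of u] that[of v] edgeD[of u v] dist_edge_end_le[of u v t] commute[of x]
    by (cases "t \<le> 1 / 2") auto
qed

lemma dist_le_vertex_diameter:
  assumes D: "\<And>u v. u \<in> V \<Longrightarrow> v \<in> V \<Longrightarrow> d (vtx u) (vtx v) \<le> D" and xy: "x \<in> X" "y \<in> X"
  shows "d x y \<le> D + 1"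
proof -
  obtain u where u: "u \<in> V" "d x (vtx u) \<le> 1 / 2" using near_vertex[OF xy(1)] .
  obtain v where v: "v \<in> V" "d y (vtx v) \<le> 1 / 2" using near_vertex[OF xy(2)] .
  have "d x y \<le> d x (vtx u) + d (vtx u) y" "d (vtx u) y \<le> d (vtx u) (vtx v) + d (vtx v) y"
    using u v xy vtx_in_X triangle by auto
  then show ?thesis using D[OF u(1) v(1)] u v commute[of y] by simp
qed

section \<open>Routes around a far point\<close>

text \<open>The invariant \<open>reached\<close> is used with the vertices joined to
  \<open>a\<close> inside \<open>F\<close> and the edges that meet them. A vertex is no interior
  point of an edge, so \<open>b\<close> has to be among these vertices.\<close>

lemma walk_of_edge_steps_vertex:
  assumes steps: "(vtx a, vtx b) \<in> (edge_steps F)\<^sup>*" and a: "a \<in> V" "vtx a \<in> F"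
  shows "(a, b) \<in> (adj_in {v \<in> V. vtx v \<in> F})\<^sup>*"
proof -
  define U where "U = {v \<in> V. vtx v \<in> F}"
  define K where "K = {v. (a, v) \<in> (adj_in U)\<^sup>*}"
  define D where "D = {e \<in> E. e \<inter> K \<noteq> {}}"
  have KU: "v \<in> U" if "v \<in> K" for v
    using that a unfolding K_def U_def
    by (auto elim!: rtranclE simp: adj_in_def)
  have "reached K D (vtx b)"
  proof (rule reached_edge_steps[OF steps])
    show "reached K D (vtx a)" by (auto simp: reached_def K_def)
    show "v \<in> K" if "{u, v} \<in> D" "vtx v \<in> F" for u v
    proof (cases "v \<in> K")
      case False
      then have u: "u \<in> K" "{u, v} \<in> E" using that by (auto simp: D_def)
      then have "(u, v) \<in> adj_in U" using KU[OF u(1)] that edgeD[OF u(2)] by (auto simp: adj_in_def U_def)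
      then show ?thesis using u(1) unfolding K_def by (auto intro: rtrancl_into_rtrancl)
    qed
  qed (auto simp: D_def)
  moreover have "vtx b \<noteq> edge_point u v t" if "{u, v} \<in> D" "0 < t" "t < 1" for u v t
    using that edgeD(3)[of u v] edge_point_interior_not_vertex[of t u v b] by (auto simp: D_def)
  ultimately have "b \<in> K" unfolding reached_def by auto
  then show ?thesis by (simp add: K_def U_def)
qed

text \<open>As \<open>a\<close> and \<open>a'\<close> are outside \<open>F\<close>, the chain can
  leave the first edge only through \<open>b\<close> and enter the second only through
  \<open>b'\<close>. The first edge belongs to \<open>D\<close> from the start, because no vertex
  has been visited yet.\<close>

lemma walk_of_edge_steps_interior:
  assumes steps: "(edge_point a b t, edge_point a' b' t') \<in> (edge_steps F)\<^sup>*"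
    and e: "{a, b} \<in> E" "0 < t" "t < 1" and e': "{a', b'} \<in> E" "0 < t'" "t' < 1"
    and a: "vtx a \<notin> F" "vtx a' \<notin> F" and ne: "{a, b} \<noteq> {a', b'}"
  shows "b \<in> V \<and> vtx b \<in> F \<and> (b, b') \<in> (adj_in {v \<in> V. vtx v \<in> F})\<^sup>*"
proof -
  define U where "U = {v \<in> V. vtx v \<in> F}"
  define K where "K = {v. b \<in> U \<and> (b, v) \<in> (adj_in U)\<^sup>*}"
  define D where "D = {e \<in> E. e \<inter> K \<noteq> {}} \<union> {{a, b}}"
  have KU: "v \<in> U" if "v \<in> K" for v
    using that unfolding K_def U_def
    by (auto elim!: rtranclE simp: adj_in_def)
  have "reached K D (edge_point a' b' t')"
  proof (rule reached_edge_steps[OF steps])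
    show "reached K D (edge_point a b t)" using e by (auto simp: reached_def D_def)
    show "v \<in> K" if "{u, v} \<in> D" "vtx v \<in> F" for u v
    proof (cases "v \<in> K \<or> {u, v} = {a, b}")
      case True
      then show ?thesis
        using that a edgeD[OF e(1)] unfolding K_def U_def by (auto simp: doubleton_eq_iff)
    next
      case False
      then have u: "u \<in> K" "{u, v} \<in> E" using that by (auto simp: D_def)
      then have "(u, v) \<in> adj_in U" using KU[OF u(1)] that edgeD[OF u(2)] by (auto simp: adj_in_def U_def)
      then show ?thesis using u(1) unfolding K_def by (auto intro: rtrancl_into_rtrancl)
    qed
  qed (use e in \<open>auto simp: D_def\<close>)
  then obtain u v \<tau> where uv: "{u, v} \<in> D" "edge_point u v \<tau> = edge_point a' b' t'"
    using edge_point_interior_not_vertex[OF e'(2,3) edgeD(3)[OF e'(1)]] unfolding reached_def by metis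
  have "{u, v} \<in> E" using uv(1) e(1) by (auto simp: D_def)
  then have "u \<noteq> v" by (rule edgeD)
  then have "{a', b'} = {u, v}"
    using edge_point_eq_interior[OF uv(2)[symmetric] e'(2,3) edgeD(3)[OF e'(1)]] by auto
  then have "{a', b'} \<inter> K \<noteq> {}" using uv ne by (auto simp: D_def)
  moreover have "a' \<notin> K" using KU a by (auto simp: U_def)
  ultimately have "b' \<in> K" by auto
  then show ?thesis by (auto simp: K_def U_def)
qed

text \<open>A distance above one means that \<open>x\<close> is off the edge of \<open>y\<close>. A
  shortest route then arrives through one end of that edge, which is named \<open>a\<close>.\<close>

lemma closer_end:
  assumes x: "x \<in> X" and y: "y \<in> X" "\<And>u. u \<in> V \<Longrightarrow> y \<noteq> vtx u" and "1 < d x y"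
  obtains a b t where "{a, b} \<in> E" "0 < t" "t < 1" "y = edge_point a b t" "d x y = d x (vtx a) + t"
  using y(1)
proof (cases rule: point_cases)
  case (interior u v t)
  note uv = edgeD[OF interior(1)]
  have "x \<noteq> edge_point u v s" if "0 \<le> s" "s \<le> 1" for s
    using dist_same_edge_le[OF interior(1) that, of t] interior that assms(4) by auto
  then have "min (d x (vtx u) + t) (d x (vtx v) + (1 - t)) \<le> d x y"
    using dist_edge_point_cases[of u v t x] interior x by simp
  moreover have "d x y \<le> d x (vtx u) + t" "d x y \<le> d x (vtx v) + (1 - t)"
    using triangle[OF x vtx_in_X[OF uv(1)] y(1)] triangle[OF x vtx_in_X[OF uv(2)] y(1)]
      dist_edge_end_le[of u v t] interior by auto
  ultimately consider "d x y = d x (vtx u) + t" | "d x y = d x (vtx v) + (1 - t)" by linarith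
  then show thesis
  proof cases
    case 1
    then show ?thesis using that interior by blast
  next
    case 2
    then show ?thesis
      using that[of v u "1 - t"] interior edge_point_swap[OF uv(3)] by (auto simp: insert_commute)
  qed
qed (use y in auto)

text \<open>The ball \<open>W\<close> around the far point and its complement \<open>U\<close> are both crossed by a walk between
  the two edges where the geodesic leaves the ball. Each walk is at most as long as the number of
  vertices it may use, and the two walks together close up to a curve of length at least \<open>4\<rho>\<close>.\<close>

lemma hyperbolicity_le_quarter_order:
  assumes n: "4 \<le> card V"
  shows "graph_hyperbolicity V E \<le> real (card V) / 4"
proof (rule hyperbolicity_le)
  fix A B C p \<sigma>
  assume *: "geodesic_triangle X d A B C" "p \<in> A" "real (card V) / 4 < \<sigma>"
    and far: "\<And>q. q \<in> B \<union> C \<Longrightarrow> \<sigma> \<le> d p q"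
  obtain g L s x where g: "g \<in> {0..L} \<rightarrow> X"
    "\<forall>a\<in>{0..L}. \<forall>b\<in>{0..L}. d (g a) (g b) = \<bar>a - b\<bar>"
    "is_geodesic X d (g 0) (g L) A" "is_geodesic X d (g L) x B" "is_geodesic X d x (g 0) C"
    "A = g ` {0..L}" "p = g s" "0 \<le> s" "s \<le> L" "\<sigma> \<le> s" "\<sigma> \<le> L - s"
    using far_point[OF *(1,2) far] by metis
  have iso: "d (g a) (g b) = \<bar>a - b\<bar>" if "0 \<le> a" "a \<le> L" "0 \<le> b" "b \<le> L" for a b
    using g(2) that by simp
  have gX: "g a \<in> X" if "0 \<le> a" "a \<le> L" for a using g(1) that by auto
  have pX: "p \<in> X" using gX g by simp
  \<comment> \<open>All but finitely many radii make both crossing points interior points of edges.\<close>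
  define I where "I = {real (card V) / 4<..<\<sigma>}"
  have I: "0 \<le> \<rho>" "\<rho> < \<sigma>" if "\<rho> \<in> I" for \<rho> using that by (auto simp: I_def)
  have inj: "inj_on (\<lambda>\<rho>. g (s - \<rho>)) I" "inj_on (\<lambda>\<rho>. g (s + \<rho>)) I"
  proof (safe intro!: inj_onI)
    fix \<rho> \<rho>' assume \<rho>: "\<rho> \<in> I" "\<rho>' \<in> I"
    note b = I[OF \<rho>(1)] I[OF \<rho>(2)]
    { assume eq: "g (s - \<rho>) = g (s - \<rho>')"
      have "d (g (s - \<rho>)) (g (s - \<rho>')) = \<bar>(s - \<rho>) - (s - \<rho>')\<bar>" "g (s - \<rho>') \<in> X"
        using b g(8-11) by (intro iso gX; linarith)+
      then have "\<bar>\<rho> - \<rho>'\<bar> = 0" unfolding eq by (simp only: mdist_zero)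
      then show "\<rho> = \<rho>'" by simp }
    { assume eq: "g (s + \<rho>) = g (s + \<rho>')"
      have "d (g (s + \<rho>)) (g (s + \<rho>')) = \<bar>(s + \<rho>) - (s + \<rho>')\<bar>" "g (s + \<rho>') \<in> X"
        using b g(8-11) by (intro iso gX; linarith)+
      then have "\<bar>\<rho> - \<rho>'\<bar> = 0" unfolding eq by (simp only: mdist_zero)
      then show "\<rho> = \<rho>'" by simp }
  qed
  have "finite (vtx ` V)" using finite_V by simp
  then have "finite (((\<lambda>\<rho>. g (s - \<rho>)) -` (vtx ` V) \<inter> I) \<union> ((\<lambda>\<rho>. g (s + \<rho>)) -` (vtx ` V) \<inter> I))"
    using inj by (intro finite_UnI finite_vimage_IntI)
  moreover have "infinite I" using *(3) by (simp add: I_def)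
  ultimately have "I - (((\<lambda>\<rho>. g (s - \<rho>)) -` (vtx ` V) \<inter> I) \<union> ((\<lambda>\<rho>. g (s + \<rho>)) -` (vtx ` V) \<inter> I)) \<noteq> {}"
    by (metis Diff_infinite_finite finite.emptyI)
  then obtain \<rho> where \<rho>: "\<rho> \<in> I" "g (s - \<rho>) \<notin> vtx ` V" "g (s + \<rho>) \<notin> vtx ` V"
    by blast
  \<comment> \<open>The assumption of at least four vertices yields \<open>1 < \<rho>\<close>, which
    \<open>closer_end\<close> requires.\<close>
  then have \<rho>n: "real (card V) / 4 < \<rho>" "\<rho> < \<sigma>" "1 < \<rho>" using n by (auto simp: I_def)
  define y1 y2 where "y1 = g (s - \<rho>)" and "y2 = g (s + \<rho>)"
  have y: "y1 \<in> X" "y2 \<in> X" "d p y1 = \<rho>" "d p y2 = \<rho>" "d y1 y2 = 2 * \<rho>"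
    using gX[of "s - \<rho>"] gX[of "s + \<rho>"] iso[of s "s - \<rho>"] iso[of s "s + \<rho>"]
      iso[of "s - \<rho>" "s + \<rho>"] g(7-11) \<rho>n by (simp_all add: y1_def y2_def)
  have nv: "y1 \<noteq> vtx u" "y2 \<noteq> vtx u" if "u \<in> V" for u
    using \<rho> that by (auto simp: y1_def y2_def)
  obtain a1 b1 t1 where 1: "{a1, b1} \<in> E" "0 < t1" "t1 < 1" "y1 = edge_point a1 b1 t1"
    "\<rho> = d p (vtx a1) + t1"
    using closer_end[OF pX y(1) nv(1)] \<rho>n(3) y(3,4) by metis
  obtain a2 b2 t2 where 2: "{a2, b2} \<in> E" "0 < t2" "t2 < 1" "y2 = edge_point a2 b2 t2"
    "\<rho> = d p (vtx a2) + t2"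
    using closer_end[OF pX y(2) nv(2)] \<rho>n(3) y(3,4) by metis
  note uv = edgeD[OF 1(1)] edgeD[OF 2(1)]
  \<comment> \<open>The ends \<open>a1\<close> and \<open>a2\<close> are at distances
    \<open>\<rho> - t1\<close> and \<open>\<rho> - t2\<close> from \<open>p\<close>. With this
    \<eta> they lie inside the ball of radius \<open>\<rho> - \<eta>\<close>, while
    \<eta>-neighbourhoods of the outer routes stay outside.\<close>
  define \<eta> where "\<eta> = min t1 t2 / 2"
  have \<eta>: "0 < \<eta>" "\<eta> < t1" "\<eta> < t2" using 1 2 by (auto simp: \<eta>_def)
  define F where "F = {z \<in> X. \<rho> - \<eta> \<le> d p z}"
  define F' where "F' = {z \<in> X. d p z < \<rho> - \<eta>}"
  define U where "U = {v \<in> V. vtx v \<in> F}"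
  define W where "W = {v \<in> V. vtx v \<in> F'}"
  have "V = U \<union> W" "U \<inter> W = {}" using vtx_in_X by (auto simp: U_def W_def F_def F'_def)
  then have card: "card V = card U + card W"
    using finite_V by (metis card_Un_disjoint finite_Un)
  have nearF: "z \<in> F" if "z \<in> X" "q \<in> X" "\<rho> \<le> d p q" "d q z < \<eta>" for z q
    using that triangle[OF pX that(1,2)] commute[of z q] by (auto simp: F_def)
  \<comment> \<open>Points of one edge are at most one apart, whereas \<open>y1\<close> and
    \<open>y2\<close> are \<open>2 * \<rho>\<close> apart.\<close>
  have ne: "{a1, b1} \<noteq> {a2, b2}"
  proof
    assume "{a1, b1} = {a2, b2}"
    then have "y2 = edge_point a1 b1 t2 \<or> y2 = edge_point a1 b1 (1 - t2)"
      using 2(4) edge_point_swap[OF uv(6), of t2] by (auto simp: doubleton_eq_iff)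
    then obtain t where t: "0 \<le> t" "t \<le> 1" "y2 = edge_point a1 b1 t"
      using 2(2,3) that[of t2] that[of "1 - t2"] by auto
    then show False using dist_same_edge_le[OF 1(1), of t1 t] 1 y(5) \<rho>n by simp
  qed
  have A: "(g a, g b) \<in> (edge_steps F)\<^sup>*"
    if "0 \<le> a" "a \<le> b" "b \<le> L" "b \<le> s - \<rho> \<or> s + \<rho> \<le> a" for a b
  proof (rule edge_steps_geodesic[OF is_geodesic_segment[where d = d and g = g, OF g(1,2) that(1-3)] \<eta>(1)])
    fix z q assume z: "z \<in> X" "q \<in> g ` {a..b}" "d q z < \<eta>"
    then obtain \<tau> where "q = g \<tau>" "a \<le> \<tau>" "\<tau> \<le> b" by auto
    then show "z \<in> F" using z that g(7-9) gX iso \<rho>n(3) by (intro nearF[of z q]) auto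
  qed
  have BC: "(g 0, g L) \<in> (edge_steps F)\<^sup>*"
  proof -
    have "(a, b) \<in> (edge_steps F)\<^sup>*" if "is_geodesic X d a b S" "S \<subseteq> B \<union> C" for a b S
    proof (rule edge_steps_geodesic[OF that(1) \<eta>(1)])
      fix z q assume z: "z \<in> X" "q \<in> S" "d q z < \<eta>"
      then have "q \<in> X" "\<sigma> \<le> d p q" using that is_geodesicD(1)[OF that(1)] far by auto
      then show "z \<in> F" using z \<rho>n(2) by (intro nearF[of z q]) auto
    qed
    then have "(g L, x) \<in> (edge_steps F)\<^sup>*" "(x, g 0) \<in> (edge_steps F)\<^sup>*"
      using g(4,5) by blast+
    then show ?thesis by (meson edge_steps_sym rtrancl_trans)
  qed
  have "(g 0, y1) \<in> (edge_steps F)\<^sup>*" "(y2, g L) \<in> (edge_steps F)\<^sup>*"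
    using A[of 0 "s - \<rho>"] A[of "s + \<rho>" L] g(8-11) \<rho>n by (simp_all add: y1_def y2_def)
  then have "(y1, y2) \<in> (edge_steps F)\<^sup>*"
    using BC by (meson edge_steps_sym rtrancl_trans)
  moreover have "vtx a1 \<notin> F" "vtx a2 \<notin> F" using 1 2 \<eta> by (auto simp: F_def)
  ultimately have b: "b1 \<in> U" "(b1, b2) \<in> (adj_in U)\<^sup>*"
    using walk_of_edge_steps_interior[of a1 b1 t1 a2 b2 t2 F] 1 2 ne unfolding U_def by auto
  have a1: "(p, vtx a1) \<in> (edge_steps F')\<^sup>*" and a2: "(p, vtx a2) \<in> (edge_steps F')\<^sup>*"
    using pX vtx_in_X uv 1 2 \<eta> by (auto intro!: edge_steps_near[of _ _ "\<rho> - \<eta>"] simp: F'_def)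
  have "a1 \<in> W" using uv vtx_in_X 1 \<eta> by (auto simp: W_def F'_def)
  moreover have "(a1, a2) \<in> (adj_in W)\<^sup>*"
    using walk_of_edge_steps_vertex[of a1 a2 F'] edge_steps_sym[OF a1] a2 \<open>a1 \<in> W\<close>
    unfolding W_def by (auto intro: rtrancl_trans)
  ultimately have W: "d (vtx a1) (vtx a2) \<le> real (card W) - 1"
    using finite_V by (intro dist_le_card) (auto simp: W_def)
  have U: "d (vtx b1) (vtx b2) \<le> real (card U) - 1"
    using b finite_V by (intro dist_le_card) (auto simp: U_def)
  \<comment> \<open>One route runs through \<open>a1\<close> and \<open>a2\<close> inside
    \<open>W\<close>, the other through \<open>b1\<close> and \<open>b2\<close> inside
    \<open>U\<close>. In the sum of both bounds the pieces of the two crossing edges add up to 2 and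
    cancel the two \<open>- 1\<close>, leaving \<open>4 * \<rho> \<le> card V\<close>.\<close>
  have "d y1 y2 \<le> d y1 (vtx u) + (d (vtx u) (vtx v) + d (vtx v) y2)" if "u \<in> V" "v \<in> V" for u v
    using triangle[OF y(1) vtx_in_X[OF that(1)] y(2)]
      triangle[OF vtx_in_X[OF that(1)] vtx_in_X[OF that(2)] y(2)] by linarith
  from this[of a1 a2] this[of b1 b2] have "2 * \<rho> \<le> t1 + (real (card W) - 1) + t2"
    "2 * \<rho> \<le> (1 - t1) + (real (card U) - 1) + (1 - t2)"
    using U W uv y(5) dist_edge_end_le[of a1 b1 t1] dist_edge_end_le[of a2 b2 t2] 1 2
      commute[of y1] by auto
  then show False using card \<rho>n(1) by simp
qed simp

text \<open>Edges have length one, so a chain cannot jump over the half-open layer from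
  \<open>lo\<close> to \<open>lo + 1\<close>: if the layer had no vertex in \<open>F\<close>, the
  chain would be confined to the edges at vertices nearer than \<open>lo\<close> and the edge of
  \<open>x\<close>.\<close>

lemma layer_has_vertex:
  assumes steps: "(x, y) \<in> (edge_steps F)\<^sup>*" and x: "x \<in> X" and lo: "0 < lo" "lo + 1 \<le> d x y"
  shows "\<exists>v\<in>V. vtx v \<in> F \<and> lo \<le> d x (vtx v) \<and> d x (vtx v) < lo + 1"
proof (rule ccontr)
  assume none: "\<not> ?thesis"
  define K where "K = {v \<in> V. d x (vtx v) < lo}"
  \<comment> \<open>The edge of \<open>x\<close> is added because \<open>x\<close> need not be a
    vertex. Its ends are nearer than \<open>lo + 1\<close>, since \<open>lo\<close> is
    positive.\<close>
  define D where "D = {e \<in> E. e \<inter> K \<noteq> {} \<or> (\<exists>u v t. e = {u, v} \<and> 0 < t \<and> t < 1 \<and> x = edge_point u v t)}"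
  have "reached K D y"
  proof (rule reached_edge_steps[OF steps])
    show "reached K D x"
      using x
    proof (cases rule: point_cases)
      case (vertex u)
      then show ?thesis using x lo by (auto simp: reached_def K_def)
    next
      case (interior u v t)
      then have "{u, v} \<in> D" by (auto simp: D_def)
      then show ?thesis using interior unfolding reached_def by blast
    qed
    fix u v assume e: "{u, v} \<in> D" "vtx v \<in> F"
    then have eE: "{u, v} \<in> E" by (simp add: D_def)
    note uv = edgeD[OF eE]
    have "d x (vtx v) < lo + 1"
    proof (cases "v \<in> K \<or> u \<in> K")
      case True
      then show ?thesis
        using triangle[OF x vtx_in_X[OF uv(1)] vtx_in_X[OF uv(2)]] dist_adjacent_le[OF eE]
        by (auto simp: K_def)
    next
      case False
      then obtain a b t where "{u, v} = {a, b}" "0 < t" "t < 1" "x = edge_point a b t"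
        using e by (auto simp: D_def)
      then show ?thesis using dist_edge_end_le[of a b t] eE lo commute[of x]
        by (auto simp: doubleton_eq_iff insert_commute)
    qed
    then show "v \<in> K" using none e uv by (auto simp: K_def)
  qed (auto simp: D_def)
  then consider u where "u \<in> K" "y = vtx u"
    | u v t where "{u, v} \<in> D" "0 < t" "t < 1" "y = edge_point u v t"
    unfolding reached_def by blast
  then show False
  proof cases
    case 1
    then show ?thesis using lo by (auto simp: K_def)
  next
    case (2 u v t)
    have e: "{u, v} \<in> E" using 2 by (simp add: D_def)
    note uv = edgeD[OF e]
    have yX: "y \<in> X" using 2 edge_point_in_graph_points[OF e, of t] by simp
    have "d x y \<le> d x (vtx u) + t" "d x y \<le> d x (vtx v) + (1 - t)"
      using triangle[OF x vtx_in_X[OF uv(1)] yX] triangle[OF x vtx_in_X[OF uv(2)] yX]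
        dist_edge_end_le[OF e, of t] 2 by auto
    then have "\<not> (u \<in> K \<or> v \<in> K)" using lo 2 by (auto simp: K_def)
    then obtain a b \<tau> where ab: "{u, v} = {a, b}" "0 < \<tau>" "\<tau> < 1" "x = edge_point a b \<tau>"
      using 2 by (auto simp: D_def)
    then have "x = edge_point u v \<tau> \<or> x = edge_point u v (1 - \<tau>)"
      using edge_point_swap[of a b \<tau>] uv(3) by (auto simp: doubleton_eq_iff)
    then obtain \<tau>' where "0 \<le> \<tau>'" "\<tau>' \<le> 1" "x = edge_point u v \<tau>'"
      using ab(2,3) that[of \<tau>] that[of "1 - \<tau>"] by auto
    then show ?thesis using dist_same_edge_le[OF e, of \<tau>' t] 2 lo by simp
  qed
qed

lemma two_vertices_per_layer:
  assumes r: "4 \<le> r" and hyp: "real r / 2 < graph_hyperbolicity V E"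
  obtains lev :: "'v \<Rightarrow> int" and w q :: "nat \<Rightarrow> 'v" and k
  where "\<And>u v. {u, v} \<in> E \<Longrightarrow> \<bar>lev u - lev v\<bar> \<le> 1"
    and "\<And>i. i < r \<Longrightarrow> w i \<in> V \<and> q i \<in> V \<and> lev (w i) = int i \<and> lev (q i) = int i"
    and "\<And>i. i < r \<Longrightarrow> w i \<noteq> q i" and "k < r" "{w k, q k} \<notin> E"
proof -
  have "\<not> graph_hyperbolicity V E \<le> real r / 2" using hyp by simp
  then obtain A B C p \<sigma> where *: "geodesic_triangle X d A B C" "p \<in> A" "real r / 2 < \<sigma>"
    and far: "\<And>q. q \<in> B \<union> C \<Longrightarrow> \<sigma> \<le> d p q"
    using hyperbolicity_le[of "real r / 2"] by force
  obtain g L s x where g: "g \<in> {0..L} \<rightarrow> X"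
    "\<forall>a\<in>{0..L}. \<forall>b\<in>{0..L}. d (g a) (g b) = \<bar>a - b\<bar>"
    "is_geodesic X d (g 0) (g L) A" "is_geodesic X d (g L) x B" "is_geodesic X d x (g 0) C"
    "A = g ` {0..L}" "p = g s" "0 \<le> s" "s \<le> L" "\<sigma> \<le> s" "\<sigma> \<le> L - s"
    using far_point[OF *(1,2) far] by metis
  have iso: "d (g a) (g b) = \<bar>a - b\<bar>" if "0 \<le> a" "a \<le> L" "0 \<le> b" "b \<le> L" for a b
    using g(2) that by simp
  have gX: "g a \<in> X" if "0 \<le> a" "a \<le> L" for a using g(1) that by auto
  have X: "p \<in> X" "g 0 \<in> X" using gX g(7-9) by auto
  define f where "f v = d (g 0) (vtx v)" for v
  \<comment> \<open>The \<open>r\<close> unit layers fill the window of radius \<open>r / 2\<close>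
    around \<open>s\<close>, the distance of \<open>p\<close> from \<open>g 0\<close>.\<close>
  define lo where "lo = s - real r / 2"
  \<comment> \<open>Eighths of the excess suffice: slack \<open>2 * \<eta>\<close> for the route
    along \<open>A\<close> stays below the \<open>7 * \<eta>\<close> that remains for the
    detour.\<close>
  define \<eta> where "\<eta> = (\<sigma> - real r / 2) / 8"
  have \<eta>: "0 < \<eta>" "\<sigma> = real r / 2 + 8 * \<eta>" using *(3) by (auto simp: \<eta>_def field_simps)
  \<comment> \<open>On \<open>A\<close> the distance from \<open>p\<close> equals the difference of
    the distances from \<open>g 0\<close>. Moving a point by less than \<eta> changes either side by
    less than \<eta>, hence the slack \<open>2 * \<eta>\<close>.\<close>
  define F where "F = {z \<in> X. d p z \<le> \<bar>d (g 0) z - s\<bar> + 2 * \<eta>}"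
  define F' where "F' = {z \<in> X. \<sigma> - \<eta> \<le> d p z}"
  have A: "(g 0, g L) \<in> (edge_steps F)\<^sup>*"
  proof (rule edge_steps_geodesic[OF g(3) \<eta>(1)])
    fix z q assume z: "z \<in> X" "q \<in> A" "d q z < \<eta>"
    then obtain t where t: "q = g t" "0 \<le> t" "t \<le> L" using g(6) by auto
    then have "d p q = \<bar>s - t\<bar>" "d (g 0) q = t" "q \<in> X" using iso g(7-9) gX by auto
    then show "z \<in> F"
      using z triangle[OF X(1) _ z(1), of q] triangle[OF X(2) z(1), of q]
        triangle[OF X(2) _ z(1), of q] commute[of z q]
      by (auto simp: F_def)
  qed
  have BC: "(g 0, g L) \<in> (edge_steps F')\<^sup>*"
  proof -
    have near: "z \<in> F'" if "z \<in> X" "q \<in> X" "\<sigma> \<le> d p q" "d q z < \<eta>" for z q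
      using that triangle[OF X(1) that(1,2)] commute[of z q] by (auto simp: F'_def)
    have "(a, b) \<in> (edge_steps F')\<^sup>*" if "is_geodesic X d a b S" "S \<subseteq> B \<union> C" for a b S
    proof (rule edge_steps_geodesic[OF that(1) \<eta>(1)])
      fix z q assume z: "z \<in> X" "q \<in> S" "d q z < \<eta>"
      then have "q \<in> X" "\<sigma> \<le> d p q" using that is_geodesicD(1)[OF that(1)] far by auto
      then show "z \<in> F'" using z by (intro near[of z q])
    qed
    then have "(g L, x) \<in> (edge_steps F')\<^sup>*" "(x, g 0) \<in> (edge_steps F')\<^sup>*"
      using g(4,5) by blast+
    then show ?thesis by (meson edge_steps_sym rtrancl_trans)
  qed
  have L: "d (g 0) (g L) = L" using iso[of 0 L] g(8,9) by simp
  have "\<exists>v\<in>V. vtx v \<in> S \<and> lo + real i \<le> f v \<and> f v < lo + real i + 1"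
    if "i < r" "(g 0, g L) \<in> (edge_steps S)\<^sup>*" for i S
  proof -
    \<comment> \<open>Both \<open>s\<close> and \<open>L - s\<close> are at least \<sigma>, which
      exceeds \<open>r / 2\<close>. So every layer begins at a positive distance from
      \<open>g 0\<close> and ends before \<open>L\<close>, the distance of
      \<open>g L\<close>.\<close>
    have "real i + 1 \<le> real r" using that by linarith
    then show ?thesis
      unfolding f_def using that(2) X L g(10,11) \<eta> by (intro layer_has_vertex) (auto simp: lo_def)
  qed
  note layer = this
  define P where "P S i v \<longleftrightarrow> v \<in> V \<and> vtx v \<in> S \<and> lo + real i \<le> f v \<and> f v < lo + real i + 1" for S i v
  have "\<forall>i. \<exists>v. i < r \<longrightarrow> P F i v" "\<forall>i. \<exists>v. i < r \<longrightarrow> P F' i v"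
    using layer A BC unfolding P_def by blast+
  then obtain w q where w: "\<And>i. i < r \<Longrightarrow> P F i (w i)" and q: "\<And>i. i < r \<Longrightarrow> P F' i (q i)"
    by metis
  note w = w[unfolded P_def, THEN conjunct1] w[unfolded P_def, THEN conjunct2, THEN conjunct1]
    w[unfolded P_def, THEN conjunct2, THEN conjunct2, THEN conjunct1]
    w[unfolded P_def, THEN conjunct2, THEN conjunct2, THEN conjunct2]
  note q = q[unfolded P_def, THEN conjunct1] q[unfolded P_def, THEN conjunct2, THEN conjunct1]
    q[unfolded P_def, THEN conjunct2, THEN conjunct2, THEN conjunct1]
    q[unfolded P_def, THEN conjunct2, THEN conjunct2, THEN conjunct2]
  show thesis
  proof (rule that[of "\<lambda>v. \<lfloor>f v - lo\<rfloor>" w q "r div 2"])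
    show "\<bar>\<lfloor>f u - lo\<rfloor> - \<lfloor>f v - lo\<rfloor>\<bar> \<le> 1" if e: "{u, v} \<in> E" for u v
    proof -
      have "\<bar>f u - f v\<bar> \<le> 1"
        using triangle[OF X(2) vtx_in_X vtx_in_X, of u v] triangle[OF X(2) vtx_in_X vtx_in_X, of v u]
          edgeD[OF e] dist_adjacent_le[OF e] commute[of "vtx u" "vtx v"] by (auto simp: f_def)
      then show ?thesis by linarith
    qed
    show "w i \<in> V \<and> q i \<in> V \<and> \<lfloor>f (w i) - lo\<rfloor> = int i \<and> \<lfloor>f (q i) - lo\<rfloor> = int i" if "i < r" for i
      using w[OF that] q[OF that] by (auto simp: floor_eq_iff)
    have dw: "d p (vtx (w i)) \<le> \<bar>f (w i) - s\<bar> + 2 * \<eta>" if "i < r" for i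
      using w(2)[OF that] by (auto simp: F_def f_def)
    have dq: "real r / 2 + 7 * \<eta> \<le> d p (vtx (q i))" if "i < r" for i
      using q(2)[OF that] \<eta>(2) by (auto simp: F'_def)
    show "w i \<noteq> q i" if "i < r" for i
    proof -
      have "real i + 1 \<le> real r" using that by linarith
      then have "\<bar>f (w i) - s\<bar> \<le> real r / 2" using w(3,4)[OF that] unfolding lo_def by linarith
      then show ?thesis using dw[OF that] dq[OF that] \<eta>(1) by auto
    qed
    show k: "r div 2 < r" using r by simp
    have "real (r div 2) \<le> real r / 2" "real r / 2 - 1 < real (r div 2)" by linarith+
    then have "\<bar>f (w (r div 2)) - s\<bar> \<le> 1" using w(3,4)[OF k] unfolding lo_def by linarith
    \<comment> \<open>Here \<open>4 \<le> r\<close> enters. In the layer that contains the level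
      \<open>s\<close>, the vertex from \<open>w\<close> is within \<open>1 + 2 * \<eta>\<close> of
      \<open>p\<close> and the one from \<open>q\<close> at least \<open>2 + 7 * \<eta>\<close>
      away, too far apart for an edge.\<close>
    moreover have "2 \<le> real r / 2" using r by simp
    ultimately have "d p (vtx (w (r div 2))) + 1 < d p (vtx (q (r div 2)))"
      using dw[OF k] dq[OF k] \<eta>(1) by linarith
    then show "{w (r div 2), q (r div 2)} \<notin> E"
      using triangle[OF X(1) vtx_in_X[OF w(1)[OF k]] vtx_in_X[OF q(1)[OF k]]] dist_adjacent_le
      by force
  qed
qed

end

section \<open>Counting edges\<close>

lemma simple_graph_edges:
  assumes "simple_graph V E"
  shows "E \<subseteq> {e. e \<subseteq> V \<and> card e = 2}" "finite E"
proof -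
  show sub: "E \<subseteq> {e. e \<subseteq> V \<and> card e = 2}" using assms by (fastforce simp: simple_graph_def)
  have "finite V" using assms by (simp add: simple_graph_def)
  then show "finite E" using sub finite_subset[of E "Pow V"] by auto
qed

text \<open>The edges are sorted by the number of ends among the \<open>2 * r\<close> selected
  vertices: \<open>E1\<close> none, \<open>E2\<close> one, \<open>E3\<close> two.\<close>

lemma card_edges_le_of_layers:
  fixes lev :: "'v \<Rightarrow> int" and w q :: "nat \<Rightarrow> 'v"
  assumes G: "simple_graph V E"
    and lev: "\<And>u v. {u, v} \<in> E \<Longrightarrow> \<bar>lev u - lev v\<bar> \<le> 1"
    and wq: "\<And>i. i < r \<Longrightarrow> w i \<in> V \<and> q i \<in> V \<and> lev (w i) = int i \<and> lev (q i) = int i"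
    and ne: "\<And>i. i < r \<Longrightarrow> w i \<noteq> q i" and k: "k < r" "{w k, q k} \<notin> E"
  shows "2 * r \<le> card V"
    and "card E \<le> (card V - 2 * r choose 2) + 6 * (card V - 2 * r) + 5 * (r - 1)"
proof -
  have fin: "finite V" using G by (simp add: simple_graph_def)
  define S where "S = w ` {..<r} \<union> q ` {..<r}"
  have SV: "S \<subseteq> V" using wq by (auto simp: S_def)
  have fS: "finite S" by (simp add: S_def)
  have "inj_on w {..<r}" "inj_on q {..<r}" using wq by (metis inj_onI lessThan_iff of_nat_eq_iff)+
  moreover have "w ` {..<r} \<inter> q ` {..<r} = {}"
  proof -
    have "w i \<noteq> q j" if "i < r" "j < r" for i j
      using wq[OF that(1)] wq[OF that(2)] ne[OF that(1)] by (metis of_nat_eq_iff)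
    then show ?thesis by auto
  qed
  ultimately have cS: "card S = 2 * r" by (simp add: S_def card_Un_disjoint card_image)
  have cVS: "card (V - S) = card V - 2 * r" using SV fS cS by (simp add: card_Diff_subset)
  show "2 * r \<le> card V" using card_mono[OF fin SV] cS by simp
  define N where "N v = {s \<in> S. \<bar>lev v - lev s\<bar> \<le> 1}" for v
  have N: "card (N v) \<le> 6" for v
  proof -
    \<comment> \<open>Negative levels become 0 under \<open>nat\<close>. This can only merge
      indices, so three layers still give at most six vertices.\<close>
    let ?I = "nat ` {lev v - 1..lev v + 1}"
    have "N v \<subseteq> w ` ?I \<union> q ` ?I"
    proof
      fix s assume s: "s \<in> N v"
      then obtain i where i: "i < r" "s = w i \<or> s = q i" by (auto simp: N_def S_def)
      then have "int i \<in> {lev v - 1..lev v + 1}" using s wq[OF i(1)] by (auto simp: N_def)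
      then have "i \<in> ?I" by force
      then show "s \<in> w ` ?I \<union> q ` ?I" using i(2) by blast
    qed
    then have "card (N v) \<le> card (w ` ?I \<union> q ` ?I)" by (rule card_mono[rotated]) simp
    also have "\<dots> \<le> card (w ` ?I) + card (q ` ?I)" by (rule card_Un_le)
    also have "\<dots> \<le> card ?I + card ?I" by (intro add_mono card_image_le) auto
    also have "\<dots> \<le> 6" using card_image_le[of "{lev v - 1..lev v + 1}" nat] by simp
    finally show ?thesis .
  qed
  define E1 where "E1 = {e. e \<subseteq> V - S \<and> card e = 2}"
  define E2 where "E2 = (\<Union>v\<in>V - S. (\<lambda>s. {v, s}) ` N v)"
  define J where "J = {..<r - 1}"
  \<comment> \<open>Consecutive layers allow four edges between them, and every layer except
    \<open>k\<close> allows one inside: \<open>5 * (r - 1)\<close> in total.\<close>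
  define E3 where "E3 = (\<lambda>i. {w i, w (Suc i)}) ` J \<union> (\<lambda>i. {q i, q (Suc i)}) ` J \<union>
    (\<lambda>i. {w i, q (Suc i)}) ` J \<union> (\<lambda>i. {q i, w (Suc i)}) ` J \<union> (\<lambda>i. {w i, q i}) ` ({..<r} - {k})"
  have E1: "card E1 = (card V - 2 * r choose 2)" "finite E1"
    using n_subsets[of "V - S" 2] fin cVS by (auto simp: E1_def)
  have fE2: "finite E2" using fin fS by (auto simp: E2_def N_def)
  have "card E2 \<le> (\<Sum>v\<in>V - S. card ((\<lambda>s. {v, s}) ` N v))"
    unfolding E2_def using fin by (intro card_UN_le) simp
  also have "\<dots> \<le> (\<Sum>v\<in>V - S. 6)"
    using fS by (intro sum_mono order_trans[OF card_image_le N]) (simp add: N_def)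
  finally have E2: "card E2 \<le> 6 * (card V - 2 * r)" using cVS by simp
  have fE3: "finite E3" by (simp add: E3_def J_def)
  have cJ: "card J = r - 1" "finite J" "card ({..<r} - {k}) = r - 1" "finite ({..<r} - {k})"
    using k by (auto simp: J_def)
  have "card E3 \<le> (r - 1) + (r - 1) + (r - 1) + (r - 1) + (r - 1)"
    unfolding E3_def using cJ
    by (intro order_trans[OF card_Un_le] add_mono) (metis card_image_le)+
  then have E3: "card E3 \<le> 5 * (r - 1)" by simp
  have "e \<in> E1 \<union> E2 \<union> E3" if e: "e \<in> E" for e
  proof -
    obtain u v where uv: "e = {u, v}" "u \<in> V" "v \<in> V" "u \<noteq> v"
      using G e unfolding simple_graph_def by blast
    have l: "\<bar>lev u - lev v\<bar> \<le> 1" using lev e uv(1) by simp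
    consider "u \<notin> S" "v \<notin> S" | "u \<notin> S" "v \<in> S" | "u \<in> S" "v \<notin> S" | "u \<in> S" "v \<in> S" by blast
    then show ?thesis
    proof cases
      case 1
      then show ?thesis using uv by (auto simp: E1_def)
    next
      case 2
      then show ?thesis using uv l by (auto simp: E2_def N_def)
    next
      case 3
      then have "u \<in> N v" "v \<in> V - S" using uv l by (auto simp: N_def)
      then have "{v, u} \<in> E2" unfolding E2_def by blast
      then show ?thesis using uv(1) by (simp add: insert_commute)
    next
      case 4
      have "{a, b} \<in> E3" if ij: "i \<le> j" "i < r" "j < r" "a = w i \<or> a = q i" "b = w j \<or> b = q j"
        and ab: "{a, b} \<in> E" "a \<noteq> b" for a b i j
      proof -
        have "j = i \<or> j = Suc i" using lev[OF ab(1)] wq[OF ij(2)] wq[OF ij(3)] ij by auto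
        then consider "j = Suc i" "i \<in> J" | "j = i" using ij by (auto simp: J_def)
        then show ?thesis
        proof cases
          case 1
          then show ?thesis using ij by (auto simp: E3_def)
        next
          case 2
          then have "{a, b} = {w i, q i}" using ij(4,5) ab(2) by auto
          moreover from this have "i \<noteq> k" using ab(1) k(2) by auto
          ultimately show ?thesis using ij(2) unfolding E3_def by blast
        qed
      qed
      note both = this
      obtain i j where "i < r" "j < r" "u = w i \<or> u = q i" "v = w j \<or> v = q j"
        using 4 by (auto simp: S_def)
      then have "{u, v} \<in> E3"
        using both[of i j u v] both[of j i v u] uv e by (cases "i \<le> j") (auto simp: insert_commute)
      then show ?thesis using uv(1) by simp
    qed
  qed
  then have "card E \<le> card (E1 \<union> E2 \<union> E3)" using E1 fE2 fE3 by (intro card_mono) auto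
  also have "\<dots> \<le> card E1 + card E2 + card E3"
    by (intro order_trans[OF card_Un_le] add_mono) auto
  finally show "card E \<le> (card V - 2 * r choose 2) + 6 * (card V - 2 * r) + 5 * (r - 1)"
    using E1 E2 E3 by simp
qed

text \<open>Each vertex except the root is assigned an edge to a vertex with smaller
  \<open>D\<close>. Two vertices cannot share such an edge, as each would then have a smaller
  \<open>D\<close> than the other.\<close>

lemma connected_graph_card_le:
  assumes "simple_graph V E" "connected_graph V E"
  shows "card V \<le> card E + 1"
proof -
  define R where "R = {(a, b). {a, b} \<in> E}"
  obtain r where r: "r \<in> V" using assms(2) by (auto simp: connected_graph_def)
  define D where "D v = (LEAST k. (r, v) \<in> R ^^ k)" for v
  have D: "(r, v) \<in> R ^^ D v" if "v \<in> V" for v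
  proof -
    have "(r, v) \<in> R\<^sup>*" using assms(2) r that by (auto simp: connected_graph_def R_def)
    then obtain k where "(r, v) \<in> R ^^ k" by (auto simp: rtrancl_power)
    then show ?thesis unfolding D_def by (rule LeastI)
  qed
  have "\<exists>u. {u, v} \<in> E \<and> D u < D v" if v: "v \<in> V" "v \<noteq> r" for v
  proof (cases "D v")
    case 0
    then show ?thesis using D[OF v(1)] v(2) by simp
  next
    case (Suc k)
    then obtain u where u: "(r, u) \<in> R ^^ k" "(u, v) \<in> R" using D[OF v(1)] by auto
    have "D u \<le> k" unfolding D_def using u(1) by (rule Least_le)
    then show ?thesis using u(2) Suc by (auto simp: R_def)
  qed
  then obtain f where f: "\<And>v. v \<in> V - {r} \<Longrightarrow> {f v, v} \<in> E \<and> D (f v) < D v" by (metis DiffE insertCI)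
  have "inj_on (\<lambda>v. {f v, v}) (V - {r})"
  proof (rule inj_onI)
    fix u v assume uv: "u \<in> V - {r}" "v \<in> V - {r}" "{f u, u} = {f v, v}"
    show "u = v"
    proof (rule ccontr)
      assume "u \<noteq> v"
      then have "u = f v" "v = f u" using uv(3) by (auto simp: doubleton_eq_iff)
      then show False using f[OF uv(1)] f[OF uv(2)] by auto
    qed
  qed
  then have "card (V - {r}) \<le> card E"
    using f by (intro card_inj_on_le[OF _ _ simple_graph_edges(2)[OF assms(1)]]) auto
  then show ?thesis using r by simp
qed

section \<open>Graphs with many edges, and trees\<close>

context metric_graph
begin

lemma dist_vtx_le_1_of_complete:
  assumes "card E = card V choose 2" "u \<in> V" "v \<in> V"
  shows "d (vtx u) (vtx v) \<le> 1"
proof (cases "u = v")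
  case True
  then show ?thesis using vtx_in_X assms by simp
next
  case False
  have "card {e. e \<subseteq> V \<and> card e = 2} = card V choose 2" "finite {e. e \<subseteq> V \<and> card e = 2}"
    using n_subsets[OF finite_V] finite_V by auto
  then have "E = {e. e \<subseteq> V \<and> card e = 2}"
    using simple_graph_edges[OF simple] assms(1) by (intro card_subset_eq) auto
  then show ?thesis using assms False by (intro dist_adjacent_le) auto
qed

text \<open>If \<open>u\<close> and \<open>v\<close> were non-adjacent without a common neighbour,
  every vertex other than \<open>u\<close> would account for a missing pair. Then at most
  \<open>card V - 1 choose 2\<close> edges would remain.\<close>

lemma dist_vtx_le_2_of_card:
  assumes m: "card V - 1 choose 2 < card E" and uv: "u \<in> V" "v \<in> V"
  shows "d (vtx u) (vtx v) \<le> 2"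
proof -
  consider "u = v" | "u \<noteq> v" "{u, v} \<in> E" | "u \<noteq> v" "{u, v} \<notin> E" by blast
  then show ?thesis
  proof cases
    case 3
    have "\<exists>w\<in>V - {u, v}. {u, w} \<in> E \<and> {w, v} \<in> E"
    proof (rule ccontr)
      assume none: "\<not> ?thesis"
      define Q where "Q = {e. e \<subseteq> V \<and> card e = 2}"
      have Q: "card Q = card V choose 2" "finite Q" "E \<subseteq> Q"
        using n_subsets[OF finite_V] finite_V simple_graph_edges[OF simple] by (auto simp: Q_def)
      \<comment> \<open>If \<open>w\<close> is adjacent to \<open>u\<close>, it is not adjacent to
        \<open>v\<close>, so \<open>f w\<close> is always a missing pair; for \<open>w = v\<close>
        it is \<open>{u, v}\<close>.\<close>
      define f where "f w = (if {u, w} \<in> E then {w, v} else {u, w})" for w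
      have "f w \<in> Q - E" if "w \<in> V - {u}" for w
      proof -
        have "w \<noteq> v" if "{u, w} \<in> E" using that 3 by blast
        then show ?thesis using that none 3 uv by (auto simp: f_def Q_def insert_commute)
      qed
      moreover have "inj_on f (V - {u})"
        using 3 by (intro inj_onI) (auto simp: f_def doubleton_eq_iff split: if_splits)
      ultimately have "card V - 1 \<le> card (Q - E)"
        using Q uv card_inj_on_le[of f "V - {u}" "Q - E"] by auto
      moreover have "card (Q - E) = card Q - card E" using Q finite_subset by (intro card_Diff_subset) auto
      moreover have "card E \<le> card Q" using Q by (intro card_mono)
      moreover have "card V choose 2 = (card V - 1) + (card V - 1 choose 2)"
        using uv finite_V by (cases "card V") (auto simp: numeral_2_eq_2)
      moreover have "2 \<le> card V" using uv 3 card_mono[OF finite_V, of "{u, v}"] by simp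
      ultimately show False using m Q(1) by linarith
    qed
    then obtain w where "w \<in> V" "{u, w} \<in> E" "{w, v} \<in> E" by blast
    then show ?thesis
      using triangle[OF vtx_in_X vtx_in_X vtx_in_X, of u w v] uv dist_adjacent_le[of u w]
        dist_adjacent_le[of w v] by simp
  qed (use vtx_in_X uv dist_adjacent_le[of u v] in auto)
qed

text \<open>The far point is first moved off the vertices. Deleting its edge splits the tree and
  puts the ends of \<open>A\<close> on different sides, so the other two sides, which join these
  ends, would have to pass through the point.\<close>

lemma hyperbolicity_tree:
  assumes tree: "card V = card E + 1"
  shows "graph_hyperbolicity V E = 0"
proof -
  have "graph_hyperbolicity V E \<le> 0"
  proof (rule hyperbolicity_le)
    fix A B C p' \<sigma>'
    assume *: "geodesic_triangle X d A B C" "p' \<in> A" "0 < \<sigma>'"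
      and far': "\<And>q. q \<in> B \<union> C \<Longrightarrow> \<sigma>' \<le> d p' q"
    obtain g L s' x where g: "g \<in> {0..L} \<rightarrow> X"
      "\<forall>a\<in>{0..L}. \<forall>b\<in>{0..L}. d (g a) (g b) = \<bar>a - b\<bar>"
      "is_geodesic X d (g 0) (g L) A" "is_geodesic X d (g L) x B" "is_geodesic X d x (g 0) C"
      "A = g ` {0..L}" "p' = g s'" "0 \<le> s'" "s' \<le> L" "\<sigma>' \<le> s'" "\<sigma>' \<le> L - s'"
      using far_point[OF *(1,2) far'] by metis
    have iso: "d (g a) (g b) = \<bar>a - b\<bar>" if "0 \<le> a" "a \<le> L" "0 \<le> b" "b \<le> L" for a b
      using g(2) that by simp
    have gX: "g a \<in> X" if "0 \<le> a" "a \<le> L" for a using g(1) that by auto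
    \<comment> \<open>Distinct vertices are at least one apart, so \<open>g s'\<close> and
      \<open>g (s' + c)\<close> cannot both be vertices if \<open>c < 1\<close>. The bound
      \<open>c < \<sigma>'\<close> keeps the moved point off the other sides.\<close>
    define c where "c = min (\<sigma>' / 2) (1 / 2)"
    have c: "0 < c" "c < \<sigma>'" "c < 1" using *(3) by (auto simp: c_def)
    have "\<exists>s. s' \<le> s \<and> s \<le> s' + c \<and> g s \<notin> vtx ` V"
    proof (rule ccontr)
      assume none: "\<not> ?thesis"
      then have "g s' \<in> vtx ` V" "g (s' + c) \<in> vtx ` V" using c by auto
      then obtain u v where "u \<in> V" "v \<in> V" "g s' = vtx u" "g (s' + c) = vtx v"
        by blast
      moreover have "d (g s') (g (s' + c)) = c" using iso[of s' "s' + c"] g(8-11) c by simp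
      ultimately show False
        using dist_vtx_ge_1[of u v] c vtx_in_X by (cases "u = v") auto
    qed
    then obtain s where s: "s' \<le> s" "s \<le> s' + c" "g s \<notin> vtx ` V" by blast
    define p where "p = g s"
    have pX: "p \<in> X" using gX s g(8-11) c by (simp add: p_def)
    have pBC: "p \<notin> B \<union> C"
    proof
      assume "p \<in> B \<union> C"
      then have "\<sigma>' \<le> d p' p" by (rule far')
      moreover have "d p' p = \<bar>s' - s\<bar>" unfolding g(7) p_def using s g(8-11) c by (intro iso) auto
      ultimately show False using s c by simp
    qed
    obtain u0 v0 t0 where e: "{u0, v0} \<in> E" "0 < t0" "t0 < 1" "p = edge_point u0 v0 t0"
      using pX
    proof (cases rule: point_cases)
      case (vertex u)
      then show ?thesis using s(3) by (auto simp: p_def)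
    qed (use that in blast)
    note uv = edgeD[OF e(1)]
    define E' where "E' = E - {{u0, v0}}"
    define R where "R = {(a, b). {a, b} \<in> E'}"
    have symR: "sym R" by (auto simp: R_def sym_def insert_commute)
    define V1 where "V1 = {v \<in> V. (u0, v) \<in> R\<^sup>*}"
    \<comment> \<open>A walk around the deleted edge would leave a connected graph with fewer than
      \<open>card V - 1\<close> edges.\<close>
    have "v0 \<notin> V1"
    proof
      assume "v0 \<in> V1"
      then have 0: "(u0, v0) \<in> R\<^sup>*" "(v0, u0) \<in> R\<^sup>*"
        using symR by (auto simp: V1_def dest: symD[OF sym_rtrancl])
      have "(a, b) \<in> R\<^sup>*" if "{a, b} \<in> E" for a b
        using that 0 by (cases "{a, b} = {u0, v0}") (auto simp: R_def E'_def doubleton_eq_iff)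
      then have "{(a, b). {a, b} \<in> E}\<^sup>* \<subseteq> R\<^sup>*" by (intro rtrancl_subset_rtrancl) auto
      then have "connected_graph V E'" using connected unfolding connected_graph_def R_def by blast
      moreover have "simple_graph V E'" using simple by (auto simp: simple_graph_def E'_def)
      ultimately have "card V \<le> card E' + 1" by (intro connected_graph_card_le)
      moreover have "card E' < card E"
        unfolding E'_def using e(1) simple_graph_edges(2)[OF simple] by (intro card_Diff1_less)
      ultimately show False using tree by simp
    qed
    then have V1: "u0 \<in> V1" "v0 \<notin> V1" "V1 \<subseteq> V" using uv by (auto simp: V1_def)
    have same: "u \<in> V1 \<longleftrightarrow> v \<in> V1" if "{u, v} \<in> E" "{u, v} \<noteq> {u0, v0}" for u v
    proof -
      have "(u, v) \<in> R" "(v, u) \<in> R" using that by (auto simp: R_def E'_def insert_commute)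
      then show ?thesis using edgeD[OF that(1)] by (auto simp: V1_def intro: rtrancl_into_rtrancl)
    qed
    \<comment> \<open>The barycentric mass on the side of \<open>u0\<close>: a Lipschitz function that attains its value at \<open>p\<close>
      nowhere else, so by the intermediate value theorem the sides of \<open>p\<close> are separated.\<close>
    define h where "h z = (\<Sum>v\<in>V1. z v * 1)" for z :: "'v \<Rightarrow> real"
    have h: "h (edge_point u v t) = (if u \<in> V1 then 1 - t else 0) + (if v \<in> V1 then t else 0)"
      if "{u, v} \<in> E" for u v t
      using barycentric_edge_point[OF that V1(3), of t "\<lambda>_. 1"] by (simp add: h_def)
    have h_lip: "\<bar>h y - h z\<bar> \<le> d y z" if "y \<in> X" "z \<in> X" for y z
    proof (rule lipschitz_le_dist[OF _ that])
      fix u v and s t :: real assume "{u, v} \<in> E"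
      then show "\<bar>h (edge_point u v s) - h (edge_point u v t)\<bar> \<le> \<bar>s - t\<bar>" by (auto simp: h)
    qed
    have h_only: "\<exists>t. 0 \<le> t \<and> t \<le> 1 \<and> z = edge_point u0 v0 t \<and> h z = 1 - t"
      if "z \<in> X" "0 < h z" "h z < 1" for z
      using that(1)
    proof (cases rule: point_cases)
      case (vertex u)
      have "finite V1" using V1(3) finite_V finite_subset by blast
      then have "h z = (if u \<in> V1 then 1 else 0)" using vertex
        by (simp add: h_def indicator_def if_distrib cong: if_cong)
      then show ?thesis using that by (auto split: if_splits)
    next
      case (interior u v t)
      then have "{u, v} = {u0, v0}" using that same[of u v] h[of u v t] by (auto split: if_splits)
      then consider "u = u0" "v = v0" | "u = v0" "v = u0" by (auto simp: doubleton_eq_iff)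
      then show ?thesis
      proof cases
        case 1
        then show ?thesis using interior V1 h[of u v t] by (intro exI[of _ t]) auto
      next
        case 2
        then show ?thesis
          using interior V1 h[of u v t] edge_point_swap[OF uv(3), of "1 - t"] by (intro exI[of _ "1 - t"]) auto
      qed
    qed
    have hp: "h p = 1 - t0" using h[OF e(1)] e V1 by simp
    have unique: "z = p" if "z \<in> X" "h z = h p" for z
      using h_only[OF that(1)] that(2) hp e by auto
    have cross: "p \<in> S" if S: "is_geodesic X d a b S" and "(h a \<le> h p \<and> h p \<le> h b) \<or> (h b \<le> h p \<and> h p \<le> h a)" for a b S
    proof -
      obtain M \<gamma> where \<gamma>: "0 \<le> M" "\<gamma> \<in> {0..M} \<rightarrow> X" "\<gamma> 0 = a" "\<gamma> M = b"
        "\<forall>s\<in>{0..M}. \<forall>t\<in>{0..M}. d (\<gamma> s) (\<gamma> t) = \<bar>s - t\<bar>" "S = \<gamma> ` {0..M}"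
        using S unfolding is_geodesic_def by blast
      have "continuous_on {0..M} (\<lambda>t. h (\<gamma> t))"
      proof (rule continuous_on_iff[THEN iffD2], intro ballI allI impI)
        fix t and \<epsilon> :: real assume t: "t \<in> {0..M}" "0 < \<epsilon>"
        have "dist (h (\<gamma> t')) (h (\<gamma> t)) \<le> dist t' t" if "t' \<in> {0..M}" for t'
        proof -
          have "\<gamma> t' \<in> X" "\<gamma> t \<in> X" "d (\<gamma> t') (\<gamma> t) = \<bar>t' - t\<bar>" using \<gamma>(2,5) that t(1) by auto
          then show ?thesis using h_lip[of "\<gamma> t'" "\<gamma> t"] by (simp add: dist_real_def)
        qed
        then show "\<exists>\<delta>>0. \<forall>t'\<in>{0..M}. dist t' t < \<delta> \<longrightarrow> dist (h (\<gamma> t')) (h (\<gamma> t)) < \<epsilon>"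
          using t(2) by (intro exI[of _ \<epsilon>]) force
      qed
      then have "\<exists>t\<ge>0. t \<le> M \<and> h (\<gamma> t) = h p"
        using that(2) \<gamma>(1,3,4) IVT'[of "\<lambda>t. h (\<gamma> t)" 0 "h p" M] IVT2'[of "\<lambda>t. h (\<gamma> t)" M "h p" 0] by auto
      then obtain t where "t \<in> {0..M}" "h (\<gamma> t) = h p" by auto
      then show ?thesis using unique[of "\<gamma> t"] \<gamma>(2,6) by (metis Pi_mem image_eqI)
    qed
    have sL: "0 < s" "s < L" using s g(8-11) c by auto
    \<comment> \<open>Within \<epsilon> of \<open>p\<close> all points are interior to its edge, so
      that \<open>h\<close> measures the distance from \<open>p\<close> exactly.\<close>
    define \<epsilon> where "\<epsilon> = min (min s (L - s)) (min t0 (1 - t0)) / 2"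
    have \<epsilon>: "0 < \<epsilon>" "\<epsilon> \<le> s" "\<epsilon> \<le> L - s" "\<epsilon> < t0" "\<epsilon> < 1 - t0"
      using sL e by (auto simp: \<epsilon>_def min_def)
    have at: "d p (g \<tau>) = \<bar>s - \<tau>\<bar>" "g \<tau> \<in> X" if "0 \<le> \<tau>" "\<tau> \<le> L" for \<tau>
      using that sL iso gX by (auto simp: p_def)
    have hdist: "\<bar>h z - h p\<bar> = d p z" if z: "z \<in> X" "d p z \<le> \<epsilon>" for z
    proof -
      have le: "\<bar>h z - h p\<bar> \<le> d p z" using h_lip[OF z(1) pX] commute[of p z] by simp
      then obtain t where t: "0 \<le> t" "t \<le> 1" "z = edge_point u0 v0 t" "h z = 1 - t"
        using h_only[OF z(1)] z(2) hp \<epsilon> by force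
      then have "d p z \<le> \<bar>t0 - t\<bar>" using dist_same_edge_le[OF e(1), of t0 t] e by simp
      then show ?thesis using le t(4) hp by simp
    qed
    have hs: "\<bar>h (g (s - \<epsilon>)) - h p\<bar> = \<epsilon>" "\<bar>h (g (s + \<epsilon>)) - h p\<bar> = \<epsilon>"
      using hdist[of "g (s - \<epsilon>)"] hdist[of "g (s + \<epsilon>)"] at[of "s - \<epsilon>"] at[of "s + \<epsilon>"] \<epsilon> sL by auto
    then have hb: "0 < h (g (s - \<epsilon>))" "h (g (s - \<epsilon>)) < 1" "0 < h (g (s + \<epsilon>))" "h (g (s + \<epsilon>)) < 1"
      using \<epsilon>(4,5) hp by linarith+
    have hne: "h (g (s - \<epsilon>)) \<noteq> h (g (s + \<epsilon>))"
    proof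
      assume "h (g (s - \<epsilon>)) = h (g (s + \<epsilon>))"
      moreover obtain t t' where "0 \<le> t" "t \<le> 1" "g (s - \<epsilon>) = edge_point u0 v0 t" "h (g (s - \<epsilon>)) = 1 - t"
        "0 \<le> t'" "t' \<le> 1" "g (s + \<epsilon>) = edge_point u0 v0 t'" "h (g (s + \<epsilon>)) = 1 - t'"
        using h_only[of "g (s - \<epsilon>)"] h_only[of "g (s + \<epsilon>)"] at(2)[of "s - \<epsilon>"] at(2)[of "s + \<epsilon>"]
          hb \<epsilon>(1-3) sL by auto
      ultimately have "g (s - \<epsilon>) = g (s + \<epsilon>)" by simp
      then have "d (g (s - \<epsilon>)) (g (s + \<epsilon>)) = 0" using at(2)[of "s + \<epsilon>"] \<epsilon> sL by simp
      then show False using iso[of "s - \<epsilon>" "s + \<epsilon>"] \<epsilon> sL by simp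
    qed
    from hs hne consider "h (g (s - \<epsilon>)) < h p" "h p < h (g (s + \<epsilon>))" | "h p < h (g (s - \<epsilon>))" "h (g (s + \<epsilon>)) < h p"
      using \<epsilon>(1) by (auto simp: abs_real_def split: if_splits)
    moreover have "\<tau> = s" if "0 \<le> \<tau>" "\<tau> \<le> L" "p = g \<tau>" for \<tau>
      using at(1)[OF that(1,2)] mdist_zero[OF pX] that(3) by auto
    then have "p \<notin> g ` S" if "S \<subseteq> {0..L} - {s}" for S using that by fastforce
    from this[of "{0..s - \<epsilon>}"] this[of "{s + \<epsilon>..L}"]
    have "p \<notin> g ` {0..s - \<epsilon>}" "p \<notin> g ` {s + \<epsilon>..L}"
      using \<epsilon>(1-3) sL by (simp_all add: subset_iff)
    \<comment> \<open>Before and after the parameter \<open>s\<close> the geodesic misses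
      \<open>p\<close>, so \<open>h\<close> does not cross \<open>h p\<close> there. The ends of
      \<open>A\<close> inherit the opposite sides found next to \<open>p\<close>.\<close>
    then have "\<not> ((h (g 0) \<le> h p \<and> h p \<le> h (g (s - \<epsilon>))) \<or> (h (g (s - \<epsilon>)) \<le> h p \<and> h p \<le> h (g 0)))"
      "\<not> ((h (g (s + \<epsilon>)) \<le> h p \<and> h p \<le> h (g L)) \<or> (h (g L) \<le> h p \<and> h p \<le> h (g (s + \<epsilon>))))"
      using cross[OF is_geodesic_segment[where d = d and g = g, OF g(1,2), of 0 "s - \<epsilon>"]]
        cross[OF is_geodesic_segment[where d = d and g = g, OF g(1,2), of "s + \<epsilon>" L]] \<epsilon> sL by auto
    moreover have "\<not> ((h (g L) \<le> h p \<and> h p \<le> h x) \<or> (h x \<le> h p \<and> h p \<le> h (g L)))"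
      "\<not> ((h x \<le> h p \<and> h p \<le> h (g 0)) \<or> (h (g 0) \<le> h p \<and> h p \<le> h x))"
      using cross[OF g(4)] cross[OF g(5)] pBC by auto
    ultimately show False by cases linarith+
  qed simp
  then show ?thesis using hyperbolicity_nonneg by simp
qed

end

section \<open>Hamiltonian cycles\<close>

context metric_graph
begin

text \<open>The hypothesis \<open>off\<close> keeps \<open>x\<close> out of the interior of the
  edge. If \<open>x\<close> is an end, comparing coordinates gives the bound; otherwise
  \<open>dist_edge_point_cases\<close> applies.\<close>

lemma dist_edge_point_ge:
  assumes e: "{u, v} \<in> E" "0 \<le> t" "t \<le> 1" and x: "x \<in> X"
    and off: "x u = 0 \<or> x v = 0"
    and c: "c \<le> d x (vtx u) + t" "c \<le> d x (vtx v) + (1 - t)"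
  shows "c \<le> d x (edge_point u v t)"
proof -
  note uv = edgeD[OF e(1)]
  have y: "edge_point u v t \<in> X" by (rule edge_point_in_graph_points[OF e])
  have ge: "\<bar>x w - edge_point u v t w\<bar> \<le> d x (edge_point u v t)" for w
    by (rule graph_dist_ge[OF simple connected x y]) (rule graph_path_length_ge[OF simple])
  show ?thesis
  proof (cases "x = vtx u \<or> x = vtx v")
    case True
    then show ?thesis
      using ge[of u] ge[of v] c uv vtx_in_X x by (auto simp: edge_point_def)
  next
    case False
    have "x \<noteq> edge_point u v s" if "0 \<le> s" "s \<le> 1" for s
    proof
      assume s: "x = edge_point u v s"
      then have "s = 0 \<or> s = 1" using off uv(3) by (auto simp: edge_point_def split: if_splits)
      then show False using False s uv(3) by (auto simp: edge_point_0 edge_point_1)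
    qed
    then show ?thesis using dist_edge_point_cases[OF e x] c by force
  qed
qed

text \<open>This supplies the case below the four vertices that
  \<open>hyperbolicity_le_quarter_order\<close> requires. The edges of any two points share a
  vertex; the two routes around the triangle have total length at most 3, so one is at most
  \<open>3 / 2\<close>.\<close>

lemma hyperbolicity_triangle_graph:
  assumes "card V = 3" "card E = 3"
  shows "graph_hyperbolicity V E \<le> 3 / 4"
proof -
  have complete: "card E = card V choose 2" using assms by (simp add: eval_nat_numeral)
  have adj: "d (vtx u) (vtx v) \<le> 1" if "u \<in> V" "v \<in> V" for u v
    using dist_vtx_le_1_of_complete[OF complete that] .
  have common: "d (edge_point u v s) (edge_point u w t) \<le> 3 / 2"
    if "{u, v} \<in> E" "{u, w} \<in> E" "0 \<le> s" "s \<le> 1" "0 \<le> t" "t \<le> 1" for u v w s t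
  proof -
    let ?x = "edge_point u v s" and ?y = "edge_point u w t"
    note V = edgeD[OF that(1)] edgeD[OF that(2)]
    have X: "?x \<in> X" "?y \<in> X"
      by (intro edge_point_in_graph_points that)+
    have "d ?x ?y \<le> d (vtx u) ?x + d (vtx u) ?y"
      using triangle[OF X(1) vtx_in_X[OF V(1)] X(2)] commute[of ?x "vtx u"] by linarith
    moreover have "d ?x ?y \<le> d (vtx v) ?x + (d (vtx v) (vtx w) + d (vtx w) ?y)"
      using triangle[OF X(1) vtx_in_X[OF V(2)] X(2)] commute[of ?x "vtx v"]
        triangle[OF vtx_in_X[OF V(2)] vtx_in_X[OF V(5)] X(2)] by linarith
    ultimately show ?thesis
      using dist_edge_end_le[OF that(1,3,4)] dist_edge_end_le[OF that(2,5,6)] adj[OF V(2,5)] by linarith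
  qed
  have on_edge: "\<exists>u v s. {u, v} \<in> E \<and> 0 \<le> s \<and> s \<le> 1 \<and> x = edge_point u v s" if "x \<in> X" for x
    using that
  proof (cases rule: point_cases)
    case (vertex u)
    have "\<exists>v\<in>V. v \<noteq> u"
    proof (rule ccontr)
      assume "\<not> ?thesis"
      then have "V \<subseteq> {u}" by blast
      then show False using assms(1) card_mono[of "{u}" V] by simp
    qed
    then obtain v where v: "v \<in> V" "v \<noteq> u" by blast
    have "card {e. e \<subseteq> V \<and> card e = 2} = card V choose 2" "finite {e. e \<subseteq> V \<and> card e = 2}"
      using n_subsets[OF finite_V] finite_V by auto
    then have "E = {e. e \<subseteq> V \<and> card e = 2}"
      using simple_graph_edges[OF simple] complete by (intro card_subset_eq) auto
    then have "{u, v} \<in> E" using v vertex by auto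
    then show ?thesis using vertex v edge_point_0[of u v] by (intro exI[of _ u] exI[of _ v] exI[of _ 0]) auto
  next
    case (interior u v t)
    then show ?thesis by (intro exI[of _ u] exI[of _ v] exI[of _ t]) auto
  qed
  have "d x y \<le> 3 / 2" if xy: "x \<in> X" "y \<in> X" for x y
  proof -
    obtain a b s where 1: "{a, b} \<in> E" "0 \<le> s" "s \<le> 1" "x = edge_point a b s" using on_edge[OF xy(1)] by blast
    obtain a' b' t where 2: "{a', b'} \<in> E" "0 \<le> t" "t \<le> 1" "y = edge_point a' b' t" using on_edge[OF xy(2)] by blast
    note V = edgeD[OF 1(1)] edgeD[OF 2(1)]
    have "{a, b} \<inter> {a', b'} \<noteq> {}"
    proof
      assume "{a, b} \<inter> {a', b'} = {}"
      then have "card {a, b, a', b'} = 4" using V by auto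
      moreover have "card {a, b, a', b'} \<le> card V" using V finite_V by (intro card_mono) auto
      ultimately show False using assms by simp
    qed
    then consider "a = a'" | "a = b'" | "b = a'" | "b = b'" by blast
    then show ?thesis
      using common[of a b b' s t] common[of a b a' s "1 - t"] common[of b a b' "1 - s" t]
        common[of b a a' "1 - s" "1 - t"] 1 2 edge_point_swap[OF V(3), of s] edge_point_swap[OF V(6), of t]
      by cases (auto simp: insert_commute)
  qed
  then show ?thesis using hyperbolicity_le_diameter[of "3 / 2"] by simp
qed

end

locale hamiltonian_graph = metric_graph "{..<n}" E for n :: nat and E +
  assumes n: "3 \<le> n" and cycle: "\<And>i. i < n \<Longrightarrow> {i, Suc i mod n} \<in> E"
begin

text \<open>Parametrisation of the cycle by arc length, wrapping modulo \<open>n\<close>. Only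
  nonnegative parameters are meaningful, because \<open>nat\<close> truncates.\<close>

definition cyc :: "real \<Rightarrow> nat \<Rightarrow> real" where
  "cyc s = edge_point (nat \<lfloor>s\<rfloor> mod n) (Suc (nat \<lfloor>s\<rfloor>) mod n) (frac s)"

lemma cyc_edge: "{i mod n, Suc i mod n} \<in> E"
  using cycle[of "i mod n"] n by (simp add: mod_Suc_eq)

lemma cyc_segment:
  assumes "real i \<le> s" "s \<le> real i + 1"
  shows "cyc s = edge_point (i mod n) (Suc i mod n) (s - real i)"
proof (cases "s = real i + 1")
  case True
  then have "nat \<lfloor>s\<rfloor> = Suc i" "frac s = 0" by (simp_all add: frac_def nat_add_distrib)
  then have "cyc s = edge_point (Suc i mod n) (Suc (Suc i) mod n) 0" unfolding cyc_def by (simp only:)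
  then show ?thesis
    using True edgeD(3)[OF cyc_edge[of i]] edgeD(3)[OF cyc_edge[of "Suc i"]]
    by (simp add: edge_point_0 edge_point_1)
next
  case False
  then have "\<lfloor>s\<rfloor> = int i" using assms by (simp add: floor_eq_iff)
  then show ?thesis by (simp add: cyc_def frac_def)
qed

lemma cyc_nat: "cyc (real i) = vtx (i mod n)"
  using cyc_segment[of i "real i"] edgeD(3)[OF cyc_edge[of i]] by (simp add: edge_point_0)

lemma segment_exists: "0 \<le> s \<Longrightarrow> \<exists>i. real i \<le> s \<and> s \<le> real i + 1"
  by (intro exI[of _ "nat \<lfloor>s\<rfloor>"]) linarith

lemma cyc_in_X: "0 \<le> s \<Longrightarrow> cyc s \<in> X"
  using segment_exists[of s] cyc_segment cyc_edge
  by (metis add.commute diff_ge_0_iff_ge diff_le_eq edge_point_in_graph_points)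

lemma cyc_periodic: "0 \<le> s \<Longrightarrow> cyc (s + real n) = cyc s"
proof -
  assume "0 \<le> s"
  then obtain i where i: "real i \<le> s" "s \<le> real i + 1" using segment_exists by blast
  have "cyc (s + real n) = edge_point ((i + n) mod n) (Suc (i + n) mod n) (s + real n - real (i + n))"
    using i by (intro cyc_segment) auto
  also have "Suc (i + n) mod n = Suc i mod n" by (metis add_Suc mod_add_self2)
  finally show ?thesis using cyc_segment[OF i] by simp
qed

lemma cyc_dist_le:
  assumes "0 \<le> s" "s \<le> t"
  shows "d (cyc s) (cyc t) \<le> t - s"
proof -
  obtain i where i: "real i \<le> s" "s \<le> real i + 1" using segment_exists assms by blast
  have seg: "d (cyc a) (cyc b) \<le> b - a" if "real j \<le> a" "a \<le> b" "b \<le> real j + 1" for j a b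
    using that dist_same_edge_le[OF cyc_edge[of j], of "a - real j" "b - real j"]
      cyc_segment[of j a] cyc_segment[of j b] by simp
  have "\<forall>t. s \<le> t \<longrightarrow> t \<le> real (i + k) + 1 \<longrightarrow> d (cyc s) (cyc t) \<le> t - s" for k
  proof (induction k)
    case 0
    then show ?case using seg[of i s] i by simp
  next
    case (Suc k)
    show ?case
    proof (intro allI impI)
      fix t assume t: "s \<le> t" "t \<le> real (i + Suc k) + 1"
      show "d (cyc s) (cyc t) \<le> t - s"
      proof (cases "t \<le> real (i + k) + 1")
        case False
        let ?m = "real (i + k) + 1"
        have "s \<le> ?m" using i by simp
        then have "d (cyc s) (cyc ?m) \<le> ?m - s" using Suc.IH by simp
        moreover have "d (cyc ?m) (cyc t) \<le> t - ?m" using seg[of "i + Suc k" ?m t] t False by simp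
        ultimately show ?thesis
          using triangle[OF cyc_in_X cyc_in_X cyc_in_X, of s ?m t] assms(1) t by simp
      qed (use Suc.IH t in blast)
    qed
  qed
  moreover obtain k :: nat where "t \<le> real k" using real_arch_simple by blast
  then have "t \<le> real (i + k) + 1" by simp
  ultimately show ?thesis using assms(2) by blast
qed

text \<open>Arc length bounds distance from above. If the ends attain the bound, the triangle
  inequality leaves no slack on any part of the arc.\<close>

lemma cyc_geodesic:
  assumes "0 \<le> a" "a \<le> b" and far: "b - a \<le> d (cyc a) (cyc b)"
  shows "is_geodesic X d (cyc a) (cyc b) (cyc ` {a..b})"
proof -
  have iso: "d (cyc (a + s)) (cyc (a + t)) = t - s" if "0 \<le> s" "s \<le> t" "t \<le> b - a" for s t
  proof -
    have "d (cyc a) (cyc b) \<le> d (cyc a) (cyc (a + s)) + (d (cyc (a + s)) (cyc (a + t)) + d (cyc (a + t)) (cyc b))"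
      using triangle[of "cyc a" "cyc (a + s)" "cyc b"] triangle[of "cyc (a + s)" "cyc (a + t)" "cyc b"]
        cyc_in_X assms that by force
    moreover have "d (cyc a) (cyc (a + s)) \<le> s" "d (cyc (a + t)) (cyc b) \<le> b - (a + t)"
      "d (cyc (a + s)) (cyc (a + t)) \<le> t - s"
      using cyc_dist_le[of a "a + s"] cyc_dist_le[of "a + t" b] cyc_dist_le[of "a + s" "a + t"] assms that by auto
    ultimately show ?thesis using far by linarith
  qed
  have iso': "d (cyc (a + s)) (cyc (a + t)) = \<bar>s - t\<bar>" if "0 \<le> s" "s \<le> b - a" "0 \<le> t" "t \<le> b - a" for s t
    using iso[of s t] iso[of t s] that commute[of "cyc (a + s)" "cyc (a + t)"] by (cases "s \<le> t") auto
  show ?thesis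
    unfolding is_geodesic_def
  proof (intro exI conjI)
    let ?g = "\<lambda>s. cyc (a + s)"
    show "0 \<le> b - a" "?g 0 = cyc a" "?g (b - a) = cyc b" using assms by auto
    show "?g \<in> {0..b - a} \<rightarrow> X" using assms cyc_in_X by auto
    show "\<forall>s\<in>{0..b - a}. \<forall>t\<in>{0..b - a}. d (?g s) (?g t) = \<bar>s - t\<bar>" using iso' by simp
    have "{a..b} = (+) a ` {0..b - a}" by simp
    then show "cyc ` {a..b} = ?g ` {0..b - a}" by (simp only: image_image)
  qed
qed

text \<open>The two halves of the cycle and a one-point third side form a geodesic triangle; the
  midpoint of the first half is tested against the second half.\<close>

lemma hyperbolicity_ge_of_bigon:
  assumes \<sigma>: "0 \<le> \<sigma>"
    and opposite: "real n / 2 \<le> d (cyc \<sigma>) (cyc (\<sigma> + real n / 2))"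
    and far: "\<And>t. \<sigma> + real n / 2 \<le> t \<Longrightarrow> t \<le> \<sigma> + real n \<Longrightarrow>
      real n / 4 \<le> d (cyc (\<sigma> + real n / 4)) (cyc t)"
  shows "real n / 4 \<le> graph_hyperbolicity {..<n} E"
proof -
  let ?y = "\<sigma> + real n / 2"
  have x: "cyc (\<sigma> + real n) = cyc \<sigma>" by (rule cyc_periodic[OF \<sigma>])
  have A: "is_geodesic X d (cyc \<sigma>) (cyc ?y) (cyc ` {\<sigma>..?y})"
    using \<sigma> opposite by (intro cyc_geodesic) auto
  have "is_geodesic X d (cyc ?y) (cyc (\<sigma> + real n)) (cyc ` {?y..\<sigma> + real n})"
    using \<sigma> opposite by (intro cyc_geodesic) (auto simp: x commute)
  then have B: "is_geodesic X d (cyc ?y) (cyc \<sigma>) (cyc ` {?y..\<sigma> + real n})" by (simp add: x)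
  have "geodesic_triangle X d (cyc ` {\<sigma>..?y}) (cyc ` {?y..\<sigma> + real n}) {cyc \<sigma>}"
    unfolding geodesic_triangle_def
    using A B geodesic_trivial[OF cyc_in_X[OF \<sigma>]] cyc_in_X[OF \<sigma>] cyc_in_X[of ?y] \<sigma> by fastforce
  then show ?thesis
  proof (rule hyperbolicity_ge)
    show "cyc (\<sigma> + real n / 4) \<in> cyc ` {\<sigma>..?y}" by auto
    show "real n / 4 \<le> d (cyc (\<sigma> + real n / 4)) q" if "q \<in> cyc ` {?y..\<sigma> + real n} \<union> {cyc \<sigma>}" for q
      using that far far[of "\<sigma> + real n"] x by auto
  qed
qed

end

section \<open>Lower bounds for cycles with chords\<close>

definition height :: "nat \<Rightarrow> nat \<Rightarrow> real" where
  "height n v = min (real v) (real n - real v)"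

text \<open>Lipschitz bounds for the distances from vertex \<open>0\<close> and from the half \<open>{n / 2..n}\<close> of the cycle.\<close>

definition half_height :: "nat \<Rightarrow> nat \<Rightarrow> real" where
  "half_height n v = (if 2 * v \<le> n then min (real v) (real n / 2 - real v) else 0)"

context hamiltonian_graph
begin

text \<open>The bigon joins vertex 0 to the point halfway round. The potential \<open>height\<close>
  keeps its ends \<open>n / 2\<close> apart despite the chords, and \<open>half_height\<close> keeps
  the midpoint of one side away from the other side.\<close>

lemma hyperbolicity_ge_of_short_edges:
  assumes height: "\<And>u v. {u, v} \<in> E \<Longrightarrow> \<bar>height n u - height n v\<bar> \<le> 1"
    and half: "\<And>u v. {u, v} \<in> E \<Longrightarrow> \<bar>half_height n u - half_height n v\<bar> \<le> 1"
  shows "real n / 4 \<le> graph_hyperbolicity {..<n} E"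
proof -
  define m where "m = n div 2"
  \<comment> \<open>The midpoint of the first half lies on the edge \<open>{i, i + 1}\<close> at
    distance \<theta> from \<open>i\<close>.\<close>
  define i where "i = n div 4"
  define \<theta> where "\<theta> = real n / 4 - real i"
  have m: "0 < m" "m + 1 < n" "2 * m = n \<or> 2 * m + 1 = n" using n by (auto simp: m_def)
  have i: "i + 1 \<le> m" "4 * i \<le> n" "n < 4 * i + 4" using n by (auto simp: i_def m_def)
  have \<theta>: "0 \<le> \<theta>" "\<theta> < 1" using i(2,3) by (auto simp: \<theta>_def)
  have e: "{i, i + 1} \<in> E" using cycle[of i] i m by simp
  define p where "p = cyc (real n / 4)"
  have p: "p = edge_point i (i + 1) \<theta>"
    using cyc_segment[of i "real n / 4"] \<theta> i m unfolding p_def \<theta>_def by simp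
  have pX: "p \<in> X" unfolding p_def by (intro cyc_in_X) simp
  have vX: "vtx v \<in> X" if "v < n" for v using vtx_in_X that by simp
  have height_le: "height n v \<le> d (vtx 0) (vtx v)" if "v < n" for v
  proof -
    have bary: "(\<Sum>w<n. vtx u w * height n w) = height n u" if "u < n" for u
      using that by (intro barycentric_vtx) simp
    have "\<bar>height n 0 - height n v\<bar> \<le> d (vtx 0) (vtx v)"
      using barycentric_le_dist[where f = "height n" and x = "vtx 0" and y = "vtx v", OF height]
        vX[OF that] vX[of 0] n that unfolding bary[OF that] by (simp only: bary)
    moreover have "height n 0 = 0" by (simp add: height_def)
    ultimately show ?thesis by simp
  qed
  \<comment> \<open>Every route from \<open>q\<close> to \<open>p\<close> passes \<open>i\<close> or
    \<open>i + 1\<close>. From a point of potential 0, the potential of either vertex plus the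
    remaining stretch to \<open>p\<close> is at least \<open>n / 4\<close>.\<close>
  have far_low: "real n / 4 \<le> d p q"
    if q: "q \<in> X" "(\<Sum>w<n. q w * half_height n w) = 0" "q i = 0 \<or> q (i + 1) = 0" for q
  proof -
    have "half_height n v \<le> d q (vtx v)" if "v < n" for v
      using barycentric_le_dist[where f = "half_height n" and x = q and y = "vtx v", OF half] q(1,2) vX[OF that] barycentric_vtx[of v "half_height n"] that
      by simp
    then have "half_height n i \<le> d q (vtx i)" "half_height n (i + 1) \<le> d q (vtx (i + 1))"
      using i m by simp_all
    moreover have "real n / 4 \<le> half_height n i + \<theta>" "real n / 4 \<le> half_height n (i + 1) + (1 - \<theta>)"
    proof -
      have "2 * real (i + 1) \<le> real n" "4 * real i \<le> real n" using i m by auto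
      then show "real n / 4 \<le> half_height n i + \<theta>" "real n / 4 \<le> half_height n (i + 1) + (1 - \<theta>)"
        using i m \<theta> by (auto simp: half_height_def \<theta>_def min_def)
    qed
    ultimately have "real n / 4 \<le> d q (edge_point i (i + 1) \<theta>)"
      using q(1,3) \<theta> by (intro dist_edge_point_ge[OF e]) auto
    then show ?thesis using commute[of p q] p by simp
  qed
  have far_vtx: "real n / 4 \<le> d p (vtx v)" if "v < n" "half_height n v = 0" for v
    using that vX by (intro far_low) (auto simp: barycentric_vtx[of v] indicator_def)
  have x: "cyc 0 = vtx 0" using cyc_nat[of 0] n by simp
  have half_edge: "cyc t = edge_point m (m + 1) (t - real m)" "{m, m + 1} \<in> E"
    if "real m \<le> t" "t \<le> real m + 1" for t
    using cyc_segment[OF that] cycle[of m] m by simp_all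
  show ?thesis
  proof (rule hyperbolicity_ge_of_bigon[of 0])
    show "real n / 2 \<le> d (cyc 0) (cyc (0 + real n / 2))"
    proof (cases "2 * m = n")
      case True
      then have "real n / 2 = real m" by linarith
      then have "cyc (0 + real n / 2) = vtx m" using cyc_nat[of m] m by simp
      then show ?thesis using x height_le[of m] m True by (simp add: height_def)
    next
      case False
      then have h: "real n / 2 = real m + 1 / 2" using m by linarith
      then have y: "cyc (0 + real n / 2) = edge_point m (m + 1) (1 / 2)" "{m, m + 1} \<in> E"
        using half_edge[of "real m + 1 / 2"] unfolding h by simp_all
      have "real n = 2 * real m + 1" using h by simp
      then have "real m \<le> d (vtx 0) (vtx m)" "real m \<le> d (vtx 0) (vtx (m + 1))"
        using height_le[of m] height_le[of "m + 1"] m by (auto simp: height_def)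
      then show ?thesis
        unfolding x y(1) using h m(1) vX[of 0] n
        by (intro dist_edge_point_ge[OF y(2)]) auto
    qed
    fix t assume t: "0 + real n / 2 \<le> t" "t \<le> 0 + real n"
    show "real n / 4 \<le> d (cyc (0 + real n / 4)) (cyc t)"
    \<comment> \<open>For odd \<open>n\<close> the second half begins in the middle of
      \<open>{m, m + 1}\<close>, and \<open>half_height\<close> is positive at \<open>m\<close>. On
      this edge the distance from \<open>p\<close> to \<open>m\<close> is bounded by the triangle
      inequality from vertex 0 instead.\<close>
    proof (cases "2 * m + 1 = n \<and> t \<le> real m + 1")
      case True
      have tm: "real m + 1 / 2 \<le> t" "t \<le> real m + 1" using True t by auto
      have "real n / 4 - 1 / 2 \<le> d p (vtx m)"
      proof -
        have "real m \<le> d (vtx 0) (vtx m)" using height_le[of m] m True by (simp add: height_def)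
        moreover have "d (vtx 0) p \<le> real n / 4" using cyc_dist_le[of 0 "real n / 4"] x by (simp add: p_def)
        moreover have "real n = 2 * real m + 1" using True by linarith
        moreover have "d (vtx 0) (vtx m) \<le> d (vtx 0) p + d p (vtx m)" using m by (intro triangle vX pX) auto
        ultimately show ?thesis by linarith
      qed
      moreover have "real n / 4 \<le> d p (vtx (m + 1))"
        using m True by (intro far_vtx) (auto simp: half_height_def)
      moreover have "p (m + 1) = 0" using p i by (simp add: edge_point_def)
      ultimately have "real n / 4 \<le> d p (edge_point m (m + 1) (t - real m))"
        using tm pX half_edge[of t] by (intro dist_edge_point_ge) auto
      then show ?thesis using half_edge(1)[of t] tm by (simp add: p_def)
    next
      case False
      \<comment> \<open>Elsewhere \<open>cyc t\<close> lies on an edge with both ends in the second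
        half, where \<open>half_height\<close> vanishes. The parameter \<open>t = n\<close> is
        assigned to the last edge, hence the witness \<open>n - 1\<close>.\<close>
      have "\<exists>j. j < n \<and> n \<le> 2 * j \<and> real j \<le> t \<and> t \<le> real j + 1"
      proof (cases "t = real n")
        case True
        then show ?thesis using n by (intro exI[of _ "n - 1"]) (auto simp: of_nat_diff)
      next
        case nt: False
        obtain j where j: "j = nat \<lfloor>t\<rfloor>" by simp
        have jt: "real j \<le> t" "t < real j + 1" using t(1) n by (simp_all add: j)
        have "n \<le> 2 * j"
        proof (cases "2 * m = n")
          case True
          then have "real m < real (j + 1)" using t(1) jt by auto
          then have "m < j + 1" unfolding of_nat_less_iff .
          then show ?thesis using True by linarith
        next
          case c: False
          then have "real (m + 1) < real (j + 1)" using m False jt by auto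
          then have "m + 1 < j + 1" unfolding of_nat_less_iff .
          then show ?thesis using m by linarith
        qed
        moreover have "real j < real n" using jt t nt by simp
        ultimately show ?thesis using jt by (intro exI[of _ j]) auto
      qed
      then obtain j where j: "j < n" "n \<le> 2 * j" "real j \<le> t" "t \<le> real j + 1" by blast
      define j' where "j' = Suc j mod n"
      have j': "j' = (if Suc j = n then 0 else Suc j)" "{j, j'} \<in> E"
        using j cycle[of j] by (auto simp: j'_def)
      have q: "cyc t = edge_point j j' (t - real j)" using cyc_segment[OF j(3,4)] j(1) by (simp add: j'_def)
      have zero: "half_height n j = 0" "half_height n j' = 0"
        using j j' n by (auto simp: half_height_def)
      have "real n / 4 \<le> d p (cyc t)"
      proof (rule far_low)
        show "cyc t \<in> X" using t n by (intro cyc_in_X) simp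
        show "(\<Sum>w<n. cyc t w * half_height n w) = 0"
          unfolding q using barycentric_edge_point[OF j'(2) order_refl] zero by simp
        show "cyc t i = 0 \<or> cyc t (i + 1) = 0"
          using j j' i m n by (auto simp: q edge_point_def)
      qed
      then show ?thesis by (simp add: p_def)
    qed
  qed simp
qed

end

text \<open>Antipodal vertices of the 4-cycle are adjacent in the complete graph, so its bigon has to join
  the midpoints of opposite edges.\<close>

lemma hyperbolicity_complete_4:
  assumes "hamiltonian_graph 4 E"
  shows "1 \<le> graph_hyperbolicity {..<4} E"
proof -
  interpret hamiltonian_graph 4 E by (rule assms)
  have Suc_mod: "Suc 0 mod 4 = 1" "Suc 1 mod 4 = 2" "Suc 2 mod 4 = 3" "Suc 3 mod 4 = 0" "Suc 4 mod 4 = 1"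
    by (simp_all add: mod_Suc)
  have E: "{0, 1} \<in> E" "{1, 2} \<in> E" "{2, 3} \<in> E" "{3, 0} \<in> E"
    using cycle[of 0] cycle[of 1] cycle[of 2] cycle[of 3] unfolding Suc_mod by simp_all
  have seg: "cyc s = edge_point 0 1 s" if "0 \<le> s" "s \<le> 1" for s
    using cyc_segment[of 0 s] that by simp
  have seg1: "cyc s = edge_point 1 2 (s - 1)" if "1 \<le> s" "s \<le> 2" for s
    using cyc_segment[of 1 s] that unfolding Suc_mod by simp
  have seg2: "cyc s = edge_point 2 3 (s - 2)" if "2 \<le> s" "s \<le> 3" for s
    using cyc_segment[of 2 s] that unfolding Suc_mod by simp
  have seg3: "cyc s = edge_point 3 0 (s - 3)" if "3 \<le> s" "s \<le> 4" for s
    using cyc_segment[of 3 s] that unfolding Suc_mod by simp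
  have seg4: "cyc s = edge_point 0 1 (s - 4)" if "4 \<le> s" "s \<le> 5" for s
    using cyc_segment[of 4 s] that unfolding Suc_mod by simp
  have vX: "vtx v \<in> X" if "v < 4" for v using vtx_in_X that by simp
  have mid_far: "3 / 2 \<le> d (edge_point u v (1 / 2)) (vtx w)"
    if e: "{u, v} \<in> E" and w: "w < 4" "w \<noteq> u" "w \<noteq> v" for u v w
  proof -
    have "3 / 2 \<le> d (vtx w) (edge_point u v (1 / 2))"
      using dist_vtx_ge_1[of w u] dist_vtx_ge_1[of w v] w edgeD[OF e] vX[OF w(1)]
      by (intro dist_edge_point_ge[OF e]) auto
    then show ?thesis by (simp add: commute)
  qed
  have mid_near: "1 / 2 \<le> d (edge_point u v (1 / 2)) (vtx u)" if e: "{u, v} \<in> E" for u v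
  proof -
    note uv = edgeD[OF e]
    have "1 / 2 \<le> d (vtx u) (edge_point u v (1 / 2))"
      using dist_vtx_ge_1[OF uv] uv vtx_in_X[OF uv(1)] by (intro dist_edge_point_ge[OF e]) auto
    then show ?thesis by (simp add: commute)
  qed
  have midX: "edge_point u v (1 / 2) \<in> X" if "{u, v} \<in> E" for u v
    using edge_point_in_graph_points[OF that, of "1 / 2"] by simp
  have "real 4 / 4 \<le> graph_hyperbolicity {..<4} E"
  proof (rule hyperbolicity_ge_of_bigon[of "1 / 2"])
    have "2 \<le> d (edge_point 0 1 (1 / 2)) (edge_point 2 3 (1 / 2))"
      using mid_far[OF E(1), of 2] mid_far[OF E(1), of 3] midX[OF E(1)]
      by (intro dist_edge_point_ge[OF E(3)]) (auto simp: edge_point_def)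
    then show "real 4 / 2 \<le> d (cyc (1 / 2)) (cyc (1 / 2 + real 4 / 2))"
      using seg[of "1 / 2"] seg2[of "5 / 2"] by simp
    fix t assume t: "1 / 2 + real 4 / 2 \<le> t" "t \<le> 1 / 2 + real 4"
    let ?p = "edge_point 1 2 (1 / 2) :: nat \<Rightarrow> real"
    have p: "cyc (1 / 2 + real 4 / 4) = ?p" using seg1[of "3 / 2"] by simp
    note pX = midX[OF E(2)]
    have near: "1 / 2 \<le> d ?p (vtx 1)" "1 / 2 \<le> d ?p (vtx 2)"
      using mid_near[OF E(2)] mid_near[of 2 1] E(2) edge_point_swap[of "1::nat" 2 "1 / 2"]
      by (simp_all add: insert_commute)
    note far = mid_far[OF E(2), of 0] mid_far[OF E(2), of 3]
    consider "t \<le> 3" | "3 \<le> t" "t \<le> 4" | "4 \<le> t" by linarith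
    then have "1 \<le> d ?p (cyc t)"
    proof cases
      case 1
      have "1 \<le> d ?p (edge_point 2 3 (t - 2))"
        using near far pX t 1 by (intro dist_edge_point_ge[OF E(3)]) (auto simp: edge_point_def)
      then show ?thesis using seg2[of t] 1 t by simp
    next
      case 2
      have "1 \<le> d ?p (edge_point 3 0 (t - 3))"
        using near far pX t 2 by (intro dist_edge_point_ge[OF E(4)]) (auto simp: edge_point_def)
      then show ?thesis using seg3[of t] 2 by simp
    next
      case 3
      have "1 \<le> d ?p (edge_point 0 1 (t - 4))"
        using near far pX t 3 by (intro dist_edge_point_ge[OF E(1)]) (auto simp: edge_point_def)
      then show ?thesis using seg4[of t] 3 t by simp
    qed
    then show "real 4 / 4 \<le> d (cyc (1 / 2 + real 4 / 4)) (cyc t)" using p by simp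
  qed simp
  then show ?thesis by simp
qed

section \<open>Extremal graphs\<close>

lemma simple_graphI:
  assumes "finite V" "E \<subseteq> {e. e \<subseteq> V \<and> card e = 2}"
  shows "simple_graph V E"
  unfolding simple_graph_def
proof (intro conjI subsetI)
  fix e assume "e \<in> E"
  then have e: "e \<subseteq> V" "card e = 2" using assms(2) by auto
  then obtain u v where "e = {u, v}" "u \<noteq> v" by (auto simp: card_2_iff)
  then show "e \<in> {{u, v} | u v. u \<in> V \<and> v \<in> V \<and> u \<noteq> v}" using e(1) by blast
qed (rule assms(1))

lemma connected_graphI:
  assumes r: "r \<in> V" and conn: "\<And>v. v \<in> V \<Longrightarrow> (r, v) \<in> {(a, b). {a, b} \<in> E}\<^sup>*"
  shows "connected_graph V E"
  unfolding connected_graph_def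
proof (intro conjI ballI)
  let ?R = "{(a, b). {a, b} \<in> E}"
  have "sym ?R" by (auto simp: sym_def insert_commute)
  then have "sym (?R\<^sup>*)" by (rule sym_rtrancl)
  fix u v assume "u \<in> V" "v \<in> V"
  then have "(u, r) \<in> ?R\<^sup>*" "(r, v) \<in> ?R\<^sup>*"
    using conn symD[OF \<open>sym (?R\<^sup>*)\<close>] by blast+
  then show "(u, v) \<in> ?R\<^sup>*" by (rule rtrancl_trans)
qed (use r in blast)

lemma card_all_edges:
  "card {e. e \<subseteq> {..<n::nat} \<and> card e = 2} = n choose 2" "finite {e. e \<subseteq> {..<n::nat} \<and> card e = 2}"
  using n_subsets[of "{..<n}" 2] by auto

text \<open>A star at vertex 0 has \<open>n - 1\<close> edges, and arbitrary further pairs can be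
  added. This makes \<open>Max\<close> in \<open>max_hyperbolicity\<close> range over a nonempty
  set.\<close>

lemma connected_graphs_nonempty:
  assumes "1 \<le> n" "n - 1 \<le> m" "m \<le> n choose 2"
  shows "connected_graphs n m \<noteq> {}"
proof -
  define Q where "Q = {e. e \<subseteq> {..<n} \<and> card e = 2}"
  define S where "S = (\<lambda>i. {0, i}) ` {1..<n}"
  have S: "S \<subseteq> Q" by (auto simp: S_def Q_def)
  have "inj_on (\<lambda>i. {0::nat, i}) {1..<n}" by (auto simp: inj_on_def doubleton_eq_iff)
  then have cS: "card S = n - 1" by (simp add: S_def card_image)
  have Q: "card Q = n choose 2" "finite Q" using card_all_edges[of n] by (simp_all add: Q_def)
  have fS: "finite S" by (simp add: S_def)
  have "card (Q - S) = (n choose 2) - (n - 1)" using card_Diff_subset[OF fS S] Q cS by simp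
  then have "m - (n - 1) \<le> card (Q - S)" using assms by simp
  then obtain T where T: "T \<subseteq> Q - S" "card T = m - (n - 1)" "finite T"
    by (rule obtain_subset_with_card_n)
  have "card (S \<union> T) = m" using T cS fS assms by (subst card_Un_disjoint) auto
  moreover have "simple_graph {..<n} (S \<union> T)"
    using S T(1) by (intro simple_graphI) (auto simp: Q_def)
  moreover have "connected_graph {..<n} (S \<union> T)"
  proof (rule connected_graphI)
    show "0 \<in> {..<n}" using assms by simp
    show "(0, v) \<in> {(a, b). {a, b} \<in> S \<union> T}\<^sup>*" if "v \<in> {..<n}" for v
    proof (cases "v = 0")
      case False
      then have "{0, v} \<in> S" using that by (auto simp: S_def)
      then show ?thesis by (intro r_into_rtrancl) simp
    qed simp
  qed
  ultimately show ?thesis by (auto simp: connected_graphs_def)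
qed

lemma metric_graph_of_connected_graphs:
  assumes "(V, E) \<in> connected_graphs n m"
  shows "metric_graph V E" "card V = n" "card E = m" "V = {..<n}"
  using assms by (auto simp: connected_graphs_def intro: metric_graph.intro)

lemma max_hyperbolicity_le:
  assumes "connected_graphs n m \<noteq> {}"
    and "\<And>V E. (V, E) \<in> connected_graphs n m \<Longrightarrow> graph_hyperbolicity V E \<le> c"
  shows "max_hyperbolicity n m \<le> c"
  unfolding max_hyperbolicity_def
  using assms by (subst Max_le_iff[OF finite_graph_hyperbolicities]) force+

lemma max_hyperbolicity_ge:
  assumes "(V, E) \<in> connected_graphs n m"
  shows "graph_hyperbolicity V E \<le> max_hyperbolicity n m"
  unfolding max_hyperbolicity_def
  using assms by (intro Max_ge finite_graph_hyperbolicities) blast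

section \<open>Cycles with short chords\<close>

definition cycle_edges :: "nat \<Rightarrow> nat set set" where
  "cycle_edges n = (\<lambda>i. {i, Suc i mod n}) ` {..<n}"

lemma cycle_edges_subset: "2 \<le> n \<Longrightarrow> cycle_edges n \<subseteq> {e. e \<subseteq> {..<n} \<and> card e = 2}"
  by (auto simp: cycle_edges_def mod_Suc card_2_iff')

lemma card_cycle_edges:
  assumes "3 \<le> n"
  shows "card (cycle_edges n) = n"
proof -
  have "inj_on (\<lambda>i. {i, Suc i mod n}) {..<n}"
    using assms by (auto simp: inj_on_def doubleton_eq_iff mod_Suc split: if_splits)
  then show ?thesis by (simp add: cycle_edges_def card_image)
qed

lemma hamiltonian_graphI:
  assumes n: "3 \<le> n" and E: "E \<subseteq> {e. e \<subseteq> {..<n} \<and> card e = 2}" "cycle_edges n \<subseteq> E"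
  shows "hamiltonian_graph n E"
proof -
  have "connected_graph {..<n} E"
  proof (rule connected_graphI)
    show "0 \<in> {..<n}" using n by simp
    show "(0, v) \<in> {(a, b). {a, b} \<in> E}\<^sup>*" if "v \<in> {..<n}" for v
      using that
    proof (induction v)
      case (Suc v)
      then have "Suc v mod n = Suc v" "v \<in> {..<n}" by simp_all
      moreover from this have "{v, Suc v mod n} \<in> cycle_edges n" unfolding cycle_edges_def by blast
      ultimately have "{v, Suc v} \<in> E" using E(2) by auto
      moreover have "(0, v) \<in> {(a, b). {a, b} \<in> E}\<^sup>*" using Suc by simp
      ultimately show ?case by (simp add: rtrancl_into_rtrancl)
    qed simp
  qed
  moreover have "simple_graph {..<n} E" using E(1) by (intro simple_graphI) auto
  ultimately show ?thesis
    using n E(2) by unfold_locales (auto simp: cycle_edges_def)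
qed

definition short_edge :: "nat \<Rightarrow> nat set \<Rightarrow> bool" where
  "short_edge n e \<longleftrightarrow> (\<exists>u v. e = {u, v} \<and> \<bar>height n u - height n v\<bar> \<le> 1 \<and>
     \<bar>half_height n u - half_height n v\<bar> \<le> 1)"

lemma short_edgeD:
  assumes "short_edge n {u, v}"
  shows "\<bar>height n u - height n v\<bar> \<le> 1" "\<bar>half_height n u - half_height n v\<bar> \<le> 1"
  using assms unfolding short_edge_def doubleton_eq_iff by (auto simp: abs_minus_commute)

lemma short_cycle_edges: "e \<in> cycle_edges n \<Longrightarrow> short_edge n e"
proof -
  assume "e \<in> cycle_edges n"
  then obtain i where i: "i < n" "e = {i, Suc i mod n}" by (auto simp: cycle_edges_def)
  have "\<bar>height n i - height n (Suc i mod n)\<bar> \<le> 1"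
    using i(1) by (cases "Suc i = n") (auto simp: height_def min_def)
  moreover have "\<bar>half_height n i - half_height n (Suc i mod n)\<bar> \<le> 1"
  proof (cases "Suc i = n")
    case True
    then show ?thesis by (auto simp: half_height_def min_def)
  next
    case False
    then have "Suc i mod n = Suc i" using i(1) by simp
    moreover have "\<bar>half_height n i - half_height n (Suc i)\<bar> \<le> 1"
      by (auto simp: half_height_def min_def)
    ultimately show ?thesis by simp
  qed
  ultimately show ?thesis using i(2) unfolding short_edge_def by blast
qed

text \<open>Two chords near vertex 0 and one near the opposite point serve. The choice of
  \<open>c\<close> makes the heights of \<open>c\<close> and \<open>c + 2\<close> differ by at most
  one for either parity of \<open>n\<close>.\<close>

lemma short_chords:
  assumes "5 \<le> n"
  shows "3 \<le> card {e. e \<subseteq> {..<n} \<and> card e = 2 \<and> e \<notin> cycle_edges n \<and> short_edge n e}"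
    (is "3 \<le> card ?C")
proof -
  define c where "c = (n - 1) div 2"
  have c: "2 * c + 1 = n \<or> 2 * c + 2 = n" "2 \<le> c" using assms by (auto simp: c_def)
  have chord: "{u, v} \<in> ?C" if "v < n" "u + 1 < v" "u \<noteq> 0"
    "\<bar>height n u - height n v\<bar> \<le> 1" "\<bar>half_height n u - half_height n v\<bar> \<le> 1" for u v
  proof -
    have "{u, v} \<noteq> {i, Suc i mod n}" if "i < n" for i
      using that \<open>v < n\<close> \<open>u + 1 < v\<close> \<open>u \<noteq> 0\<close> by (auto simp: doubleton_eq_iff mod_Suc split: if_splits)
    then show ?thesis using that by (auto simp: cycle_edges_def short_edge_def)
  qed
  have "{1, n - 1} \<in> ?C"
    using assms by (intro chord) (auto simp: height_def half_height_def min_def of_nat_diff)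
  moreover have "{1, n - 2} \<in> ?C"
    using assms by (intro chord) (auto simp: height_def half_height_def min_def of_nat_diff)
  moreover have "{c, c + 2} \<in> ?C"
    using c by (intro chord) (auto simp: height_def half_height_def min_def field_simps)
  ultimately have "card {{1, n - 1}, {1, n - 2}, {c, c + 2}} \<le> card ?C"
    using card_all_edges(2)[of n] by (intro card_mono) (auto intro: rev_finite_subset)
  moreover have "card {{1, n - 1}, {1, n - 2}, {c, c + 2}} = 3"
    using assms c by (auto simp: doubleton_eq_iff card_insert_if)
  ultimately show ?thesis by simp
qed

lemma short_chord_4: "1 \<le> card {e. e \<subseteq> {..<4} \<and> card e = 2 \<and> e \<notin> cycle_edges 4 \<and> short_edge 4 e}"
  (is "1 \<le> card ?C")
proof -
  have "{1, 3} \<notin> cycle_edges 4" by (auto simp: cycle_edges_def doubleton_eq_iff mod_Suc split: if_splits)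
  moreover have "short_edge 4 {1, 3}"
    unfolding short_edge_def
    by (intro exI[of _ 1] exI[of _ 3]) (simp add: height_def half_height_def min_def)
  ultimately have "{1, 3} \<in> ?C" by simp
  then have "card {{1, 3::nat}} \<le> card ?C"
    using card_all_edges(2)[of 4] by (intro card_mono) (auto intro: rev_finite_subset)
  then show ?thesis by simp
qed

text \<open>The cycle receives \<open>m - n\<close> short chords, at most three. On four vertices
  \<open>{0, 2}\<close> is not short, so the complete graph is treated separately.\<close>

lemma quarter_order_attained:
  assumes n: "3 \<le> n" and m: "n \<le> m" "m \<le> n + 3" "m \<le> n choose 2"
  shows "\<exists>V E. (V, E) \<in> connected_graphs n m \<and> real n / 4 \<le> graph_hyperbolicity V E"
proof (cases "n = 4 \<and> m = 6")
  case True
  define E where "E = {e. e \<subseteq> {..<n} \<and> card e = 2}"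
  have "hamiltonian_graph n E"
    using cycle_edges_subset[of n] n by (intro hamiltonian_graphI) (auto simp: E_def)
  then interpret hamiltonian_graph n E .
  have "n choose 2 = m" using True by (simp add: eval_nat_numeral)
  then have "({..<n}, E) \<in> connected_graphs n m"
    using simple connected card_all_edges(1)[of n] by (simp add: connected_graphs_def E_def)
  moreover have "real n / 4 \<le> graph_hyperbolicity {..<n} E"
    using hyperbolicity_complete_4[of E] hamiltonian_graph_axioms True by simp
  ultimately show ?thesis by blast
next
  case False
  define C where "C = {e. e \<subseteq> {..<n} \<and> card e = 2 \<and> e \<notin> cycle_edges n \<and> short_edge n e}"
  have "m - n \<le> card C"
  proof -
    consider "n = 3" | "n = 4" | "5 \<le> n" using n by linarith
    then show ?thesis
    proof cases
      case 1
      then show ?thesis using m(3) by (simp add: eval_nat_numeral)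
    next
      case 2
      then have "m \<le> 6" using m(3) by (simp add: eval_nat_numeral)
      then show ?thesis using 2 False short_chord_4 unfolding C_def by simp
    next
      case 3
      then show ?thesis using short_chords[OF 3] m(2) unfolding C_def by linarith
    qed
  qed
  then obtain T where T: "T \<subseteq> C" "card T = m - n" "finite T" by (rule obtain_subset_with_card_n)
  define E where "E = cycle_edges n \<union> T"
  have "hamiltonian_graph n E"
    using cycle_edges_subset[of n] n T(1) by (intro hamiltonian_graphI) (auto simp: E_def C_def)
  then interpret hamiltonian_graph n E .
  have "card E = m"
    unfolding E_def using T card_cycle_edges[OF n] m(1)
    by (subst card_Un_disjoint) (auto simp: C_def cycle_edges_def)
  then have "({..<n}, E) \<in> connected_graphs n m"
    using simple connected by (simp add: connected_graphs_def)
  moreover have "short_edge n e" if "e \<in> E" for e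
    using that T(1) short_cycle_edges by (auto simp: E_def C_def)
  then have "real n / 4 \<le> graph_hyperbolicity {..<n} E"
    using short_edgeD by (intro hyperbolicity_ge_of_short_edges) blast+
  ultimately show ?thesis by blast
qed

section \<open>Edge thresholds and the final bounds\<close>

lemma real_choose_two: "real (n choose 2) = real n * (real n - 1) / 2"
proof -
  have "even (n * (n - 1))" by (cases n) auto
  then have "2 * (n choose 2) = n * (n - 1)" by (simp add: choose_two)
  then have "2 * real (n choose 2) = real n * real (n - 1)" by (metis of_nat_mult of_nat_numeral)
  then show ?thesis by (cases n) auto
qed

text \<open>For \<open>r = 2\<close> the threshold is one less than \<open>n choose 2\<close>, which
  forces a complete graph; for \<open>r = 3\<close> it equals \<open>n - 1 choose 2\<close>. Vertex
  diameter \<open>r - 1\<close> then gives diameter at most \<open>r\<close>. For larger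
  \<open>r\<close> the count over layers equals the threshold.\<close>

lemma hyperbolicity_le_of_edge_threshold:
  assumes G: "(V, E) \<in> connected_graphs n m" and m: "m \<le> n choose 2"
    and r: "2 \<le> r" "edge_threshold n r < real m"
  shows "graph_hyperbolicity V E \<le> real r / 2"
proof -
  interpret metric_graph V E by (rule metric_graph_of_connected_graphs[OF G])
  note V = metric_graph_of_connected_graphs(2,3)[OF G]
  consider "r = 2" | "r = 3" | "4 \<le> r" using r(1) by linarith
  then show ?thesis
  proof cases
    case 1
    then have "real (n choose 2) < real m + 1"
      using r(2) by (simp add: edge_threshold_def real_choose_two power2_eq_square field_simps)
    then have "card E = card V choose 2" using m V by simp
    then show ?thesis
      using hyperbolicity_le_diameter[OF dist_le_vertex_diameter[OF dist_vtx_le_1_of_complete]] 1 by simp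
  next
    case 2
    obtain k where "n = Suc k" using V V_nonempty finite_V by (metis card_eq_0_iff not0_implies_Suc)
    then have "real (n - 1 choose 2) < real m"
      using r(2) 2 by (simp add: edge_threshold_def real_choose_two power2_eq_square field_simps)
    then have "card V - 1 choose 2 < card E" using V by simp
    then show ?thesis
      using hyperbolicity_le_diameter[OF dist_le_vertex_diameter[OF dist_vtx_le_2_of_card]] 2 by simp
  next
    case 3
    show ?thesis
    proof (rule ccontr)
      assume "\<not> ?thesis"
      then have "real r / 2 < graph_hyperbolicity V E" by simp
      from two_vertices_per_layer[OF 3 this] obtain lev :: "nat \<Rightarrow> int" and w q k where lev:
        "\<And>u v. {u, v} \<in> E \<Longrightarrow> \<bar>lev u - lev v\<bar> \<le> 1"
        "\<And>i. i < r \<Longrightarrow> w i \<in> V \<and> q i \<in> V \<and> lev (w i) = int i \<and> lev (q i) = int i"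
        "\<And>i. i < r \<Longrightarrow> w i \<noteq> q i" "k < r" "{w k, q k} \<notin> E"
        by blast
      note le = card_edges_le_of_layers[OF simple lev]
      define j where "j = n - 2 * r"
      have n: "real n = real j + 2 * real r" using le(1) V by (simp add: j_def)
      have "real m \<le> real ((j choose 2) + 6 * j + 5 * (r - 1))"
        using le(2) V by (simp add: j_def)
      also have "\<dots> = real j * (real j - 1) / 2 + 6 * real j + 5 * (real r - 1)"
        using 3 by (simp add: real_choose_two of_nat_diff)
      also have "\<dots> = edge_threshold n r"
        using 3 by (simp add: edge_threshold_def n power2_eq_square field_simps)
      finally show False using r(2) by simp
    qed
  qed
qed

theorem theorem2p13:
  fixes n m :: nat
  assumes "n \<ge> 1" and "n - 1 \<le> m" and "m \<le> n choose 2"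
  shows "(m = n - 1 \<longrightarrow> max_hyperbolicity n m = 0) \<and>
    (n \<ge> 3 \<and> n \<le> m \<and> m \<le> n + 3 \<longrightarrow> max_hyperbolicity n m = real n / 4) \<and>
    (\<forall>r::nat. 2 \<le> r \<and> real r \<le> real n / 2 \<and>
        edge_threshold n r < real m \<and> real m \<le> edge_threshold n (r - 1) \<longrightarrow>
        max_hyperbolicity n m \<le> real r / 2)"
proof (intro conjI impI allI)
  note ne = connected_graphs_nonempty[OF assms]
  show "max_hyperbolicity n m = 0" if "m = n - 1"
  proof -
    have "graph_hyperbolicity V E = 0" if G: "(V, E) \<in> connected_graphs n m" for V E
    proof -
      interpret metric_graph V E by (rule metric_graph_of_connected_graphs[OF G])
      show ?thesis
        using metric_graph_of_connected_graphs(2,3)[OF G] \<open>m = n - 1\<close> assms(1)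
        by (intro hyperbolicity_tree) simp
    qed
    then show ?thesis
      using max_hyperbolicity_le[OF ne, of 0] max_hyperbolicity_ge[of _ _ n m] ne by force
  qed
  show "max_hyperbolicity n m = real n / 4" if nm: "n \<ge> 3 \<and> n \<le> m \<and> m \<le> n + 3"
  proof (rule antisym)
    show "max_hyperbolicity n m \<le> real n / 4"
    proof (rule max_hyperbolicity_le[OF ne])
      fix V E assume G: "(V, E) \<in> connected_graphs n m"
      interpret metric_graph V E by (rule metric_graph_of_connected_graphs[OF G])
      note V = metric_graph_of_connected_graphs(2,3)[OF G]
      show "graph_hyperbolicity V E \<le> real n / 4"
      proof (cases "n = 3")
        case True
        then have "m = 3" using nm assms(3) by (simp add: eval_nat_numeral)
        then show ?thesis using hyperbolicity_triangle_graph True V by simp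
      next
        case False
        then show ?thesis using hyperbolicity_le_quarter_order nm V by simp
      qed
    qed
    show "real n / 4 \<le> max_hyperbolicity n m"
      using quarter_order_attained[of n m] nm assms(3) max_hyperbolicity_ge order_trans by blast
  qed
  show "max_hyperbolicity n m \<le> real r / 2"
    if "2 \<le> r \<and> real r \<le> real n / 2 \<and> edge_threshold n r < real m \<and>
      real m \<le> edge_threshold n (r - 1)" for r
    using that by (intro max_hyperbolicity_le[OF ne] hyperbolicity_le_of_edge_threshold[OF _ assms(3)]) auto
qed

end
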